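(* Let $\mathcal M=(\Theta,C,<)$ be a generic ordered $C$-set. Then $\mathcal M$ has a transitive extension which in canonical form is a circularly ordered $D$-set.
   Context: **Extensions.** A one-point extension of a structure $\mathcal M$ with universe $M$ is a first-order structure $\mathcal M'$ with universe $M\cup\{0\}$, $0\notin M$, such that the stabilizer $\mathrm{Aut}(\mathcal M')_0$, acting on $M$, equals $\mathrm{Aut}(\mathcal M)$. It is a transitive extension if $\mathrm{Aut}(\mathcal M')$ is transitive on $M\cup\{0\}$. A transitive extension of a structure with relations $R_1,\dots,R_n$ is in canonical form if its language consists of relations $R_1',\dots,R_n'$, each $R_i'$ of arity one more than $R_i$, such that $R_i(\overline x)\Leftrightarrow R_i'(\overline x,0)$ for all tuples $\overline x$ from $M$ of the appropriate length. Here, up to the placement of the argument $0$, the canonical form has relations $D$ (quaternary) and $\gamma$ (ternary) on $\Theta\cup\{0\}$ with $C(x;yz)\Leftrightarrow D(0x;yz)$ and $x<y\Leftrightarrow\gamma(x,y,0)$ for $x,y,z\in\Theta$. **$C$-sets.** A $C$-set is a set with a ternary relation $C$ satisfying, for all $a,b,c,d$: (C1) $C(a;bc)\to C(a;cb)$; (C2) $C(a;bc)\to\neg C(b;ac)$; (C3) $C(a;bc)\to C(a;dc)\vee C(d;bc)$; (C4) $a\ne b\to C(a;bb)$. An ordered $C$-set is a structure $(\Theta,C,<)$ where $C$ is a $C$-relation and $<$ is a linear order, satisfying $C(x;yz)\to\neg((y<x<z)\vee(z<x<y))$. The generic ordered $C$-set is the Fraïssé limit of the class of finite ordered $C$-sets.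 **$D$-sets.** A $D$-set is a set with a quaternary relation $D$ satisfying, for all $w,x,y,z$: (D1) $D(wx;yz)\to(D(xw;yz)\wedge D(yz;wx))$; (D2) $D(wx;yz)\to\neg D(wy;xz)$; (D3) $D(wx;yz)\to\forall v\,(D(vx;yz)\vee D(wx;yv))$; (D4) $(w\ne y\wedge x\ne y)\to D(wx;yy)$. A circularly ordered $D$-set is a structure $(\Omega,D,\gamma)$ where $D$ is a $D$-relation and $\gamma$ is a (ternary, strict) circular ordering of $\Omega$, satisfying $$D(xy;zw)\to\neg([x,z,y,w]\vee[w,y,z,x]),$$ where $[p,q,r,s]$ means that $p,q,r,s$ are distinct and occur in this cyclic order, i.e. $\gamma(p,q,r)$, $\gamma(q,r,s)$, $\gamma(r,s,p)$ and $\gamma(s,p,q)$ hold. *)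

theory Defs
  imports Main "HOL-Library.Countable_Set" "HOL-Combinatorics.Permutations"
begin

section \<open>Relational structures\<close>

text \<open>
  The type \<open>'r\<close> is the set of relation symbols. Every definition below evaluates \<open>rel M r\<close> only on
  lists of length \<open>arity M r\<close> with entries in \<open>universe M\<close>; other values carry no meaning.
\<close>

record ('a, 'r) rel_structure =
  universe :: "'a set"
  arity :: "'r \<Rightarrow> nat"
  rel :: "'r \<Rightarrow> 'a list \<Rightarrow> bool"

definition tuples :: "('a, 'r) rel_structure \<Rightarrow> 'r \<Rightarrow> 'a list set" where
  "tuples M r = {xs. length xs = arity M r \<and> set xs \<subseteq> universe M}"

definition embedding :: "('a, 'r) rel_structure \<Rightarrow> ('b, 'r) rel_structure \<Rightarrow> ('a \<Rightarrow> 'b) \<Rightarrow> bool" where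
  "embedding A B f \<longleftrightarrow>
     arity A = arity B \<and> inj_on f (universe A) \<and> f ` universe A \<subseteq> universe B \<and>
     (\<forall>r. \<forall>xs \<in> tuples A r. rel A r xs \<longleftrightarrow> rel B r (map f xs))"

definition isomorphism :: "('a, 'r) rel_structure \<Rightarrow> ('b, 'r) rel_structure \<Rightarrow> ('a \<Rightarrow> 'b) \<Rightarrow> bool" where
  "isomorphism A B f \<longleftrightarrow> embedding A B f \<and> f ` universe A = universe B"

text \<open>Automorphisms are normalised to be the identity outside the universe.\<close>

definition Aut :: "('a, 'r) rel_structure \<Rightarrow> ('a \<Rightarrow> 'a) set" where
  "Aut M = {g. g permutes universe M \<and> isomorphism M M g}"

definition substructure :: "('a, 'r) rel_structure \<Rightarrow> 'a set \<Rightarrow> ('a, 'r) rel_structure" where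
  "substructure M F = M\<lparr>universe := F\<rparr>"

definition homogeneous :: "('a, 'r) rel_structure \<Rightarrow> bool" where
  "homogeneous M \<longleftrightarrow>
     (\<forall>F G f. finite F \<and> F \<subseteq> universe M \<and> G \<subseteq> universe M \<and>
        isomorphism (substructure M F) (substructure M G) f \<longrightarrow>
        (\<exists>g \<in> Aut M. \<forall>x \<in> F. g x = f x))"

text \<open>
  The last two conjuncts say that the age of \<open>M\<close> is \<open>K\<close>, up to isomorphism. As the language is
  relational, finitely generated substructures are the finite ones. The members of \<open>K\<close> may live on a
  different type; for a class of finite structures, \<^typ>\<open>nat\<close> provides all isomorphism types.
\<close>

definition Fraisse_limit :: "('b, 'r) rel_structure set \<Rightarrow> ('a, 'r) rel_structure \<Rightarrow> bool" where
  "Fraisse_limit K M \<longleftrightarrow>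
     countable (universe M) \<and> homogeneous M \<and>
     (\<forall>A \<in> K. \<exists>f. embedding A M f) \<and>
     (\<forall>F. finite F \<and> F \<subseteq> universe M \<longrightarrow> (\<exists>A \<in> K. \<exists>f. isomorphism A (substructure M F) f))"


section \<open>Transitive extensions\<close>

text \<open>
  The new point \<open>0\<close> is \<^term>\<open>None\<close>, and \<open>M\<close> is identified with its image under \<^term>\<open>Some\<close>, so that
  \<open>0\<close> is outside \<open>M\<close> even if the universe of \<open>M\<close> is the whole type. For \<open>g\<close> fixing \<^term>\<open>None\<close>,
  the map \<open>the \<circ> g \<circ> Some\<close> is the permutation that \<open>g\<close> induces on \<open>M\<close>. The language of the extension
  is unrelated to that of \<open>M\<close>.
\<close>

definition one_point_extension ::
    "('a, 'r) rel_structure \<Rightarrow> ('a option, 's) rel_structure \<Rightarrow> bool" where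
  "one_point_extension M M' \<longleftrightarrow>
     universe M' = insert None (Some ` universe M) \<and>
     (\<lambda>g. the \<circ> g \<circ> Some) ` {g \<in> Aut M'. g None = None} = Aut M"

definition transitive_extension ::
    "('a, 'r) rel_structure \<Rightarrow> ('a option, 's) rel_structure \<Rightarrow> bool" where
  "transitive_extension M M' \<longleftrightarrow>
     one_point_extension M M' \<and>
     (\<forall>x \<in> universe M'. \<forall>y \<in> universe M'. \<exists>g \<in> Aut M'. g x = y)"

text \<open>
  The relation of \<open>M'\<close> corresponding to \<open>R\<^sub>i\<close> carries the same symbol. The number \<open>pos r\<close> is the
  (0-based) argument place of that relation at which the new point is put.
\<close>

definition canonical_form ::
    "('r \<Rightarrow> nat) \<Rightarrow> ('a, 'r) rel_structure \<Rightarrow> ('a option, 'r) rel_structure \<Rightarrow> bool" where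
  "canonical_form pos M M' \<longleftrightarrow>
     (\<forall>r. pos r \<le> arity M r \<and> arity M' r = Suc (arity M r) \<and>
        (\<forall>xs \<in> tuples M r. rel M r xs \<longleftrightarrow>
           rel M' r (map Some (take (pos r) xs) @ None # map Some (drop (pos r) xs))))"


section \<open>Ordered C-sets\<close>

text \<open>\<open>C a b c\<close> stands for $C(a;bc)$.\<close>

definition C_set :: "'a set \<Rightarrow> ('a \<Rightarrow> 'a \<Rightarrow> 'a \<Rightarrow> bool) \<Rightarrow> bool" where
  "C_set \<Theta> C \<longleftrightarrow>
     (\<forall>a\<in>\<Theta>. \<forall>b\<in>\<Theta>. \<forall>c\<in>\<Theta>. \<forall>d\<in>\<Theta>.
        (C a b c \<longrightarrow> C a c b) \<and>
        (C a b c \<longrightarrow> \<not> C b a c) \<and>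
        (C a b c \<longrightarrow> C a d c \<or> C d b c) \<and>
        (a \<noteq> b \<longrightarrow> C a b b))"

definition ordered_C_set ::
    "'a set \<Rightarrow> ('a \<Rightarrow> 'a \<Rightarrow> 'a \<Rightarrow> bool) \<Rightarrow> ('a \<Rightarrow> 'a \<Rightarrow> bool) \<Rightarrow> bool" where
  "ordered_C_set \<Theta> C lt \<longleftrightarrow>
     C_set \<Theta> C \<and>
     irreflp_on \<Theta> lt \<and> transp_on \<Theta> lt \<and> totalp_on \<Theta> lt \<and>
     (\<forall>x\<in>\<Theta>. \<forall>y\<in>\<Theta>. \<forall>z\<in>\<Theta>.
        C x y z \<longrightarrow> \<not> ((lt y x \<and> lt x z) \<or> (lt z x \<and> lt x y)))"

text \<open>
  \<open>Branching\<close> names $C$ in an ordered C-set and $D$ in a circularly ordered D-set; \<open>Ordering\<close> names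
  $<$ and $\gamma$ respectively.
\<close>

datatype symbol = Branching | Ordering

definition C_structure ::
    "'a set \<Rightarrow> ('a \<Rightarrow> 'a \<Rightarrow> 'a \<Rightarrow> bool) \<Rightarrow> ('a \<Rightarrow> 'a \<Rightarrow> bool) \<Rightarrow> ('a, symbol) rel_structure" where
  "C_structure \<Theta> C lt =
     \<lparr>universe = \<Theta>,
      arity = case_symbol 3 2,
      rel = case_symbol (\<lambda>xs. C (xs ! 0) (xs ! 1) (xs ! 2)) (\<lambda>xs. lt (xs ! 0) (xs ! 1))\<rparr>"

definition finite_ordered_C_sets :: "(nat, symbol) rel_structure set" where
  "finite_ordered_C_sets = {C_structure A C lt | A C lt. finite A \<and> ordered_C_set A C lt}"

definition generic_ordered_C_set ::
    "'a set \<Rightarrow> ('a \<Rightarrow> 'a \<Rightarrow> 'a \<Rightarrow> bool) \<Rightarrow> ('a \<Rightarrow> 'a \<Rightarrow> bool) \<Rightarrow> bool" where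
  "generic_ordered_C_set \<Theta> C lt \<longleftrightarrow> Fraisse_limit finite_ordered_C_sets (C_structure \<Theta> C lt)"


section \<open>Circularly ordered D-sets\<close>

text \<open>\<open>D w x y z\<close> stands for $D(wx;yz)$.\<close>

definition D_set :: "'a set \<Rightarrow> ('a \<Rightarrow> 'a \<Rightarrow> 'a \<Rightarrow> 'a \<Rightarrow> bool) \<Rightarrow> bool" where
  "D_set \<Omega> D \<longleftrightarrow>
     (\<forall>w\<in>\<Omega>. \<forall>x\<in>\<Omega>. \<forall>y\<in>\<Omega>. \<forall>z\<in>\<Omega>.
        (D w x y z \<longrightarrow> D x w y z \<and> D y z w x) \<and>
        (D w x y z \<longrightarrow> \<not> D w y x z) \<and>
        (D w x y z \<longrightarrow> (\<forall>v\<in>\<Omega>. D v x y z \<or> D w x y v)) \<and>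
        (w \<noteq> y \<and> x \<noteq> y \<longrightarrow> D w x y y))"

text \<open>The first two axioms imply that \<open>\<gamma> x y z\<close> holds only for distinct arguments.\<close>

definition circular_order :: "'a set \<Rightarrow> ('a \<Rightarrow> 'a \<Rightarrow> 'a \<Rightarrow> bool) \<Rightarrow> bool" where
  "circular_order \<Omega> \<gamma> \<longleftrightarrow>
     (\<forall>x\<in>\<Omega>. \<forall>y\<in>\<Omega>. \<forall>z\<in>\<Omega>. \<gamma> x y z \<longrightarrow> \<gamma> y z x) \<and>
     (\<forall>x\<in>\<Omega>. \<forall>y\<in>\<Omega>. \<forall>z\<in>\<Omega>. \<gamma> x y z \<longrightarrow> \<not> \<gamma> x z y) \<and>
     (\<forall>x\<in>\<Omega>. \<forall>y\<in>\<Omega>. \<forall>z\<in>\<Omega>. \<forall>w\<in>\<Omega>. \<gamma> x y z \<and> \<gamma> x z w \<longrightarrow> \<gamma> x y w) \<and>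
     (\<forall>x\<in>\<Omega>. \<forall>y\<in>\<Omega>. \<forall>z\<in>\<Omega>. distinct [x, y, z] \<longrightarrow> \<gamma> x y z \<or> \<gamma> x z y)"

definition cyclic4 :: "('a \<Rightarrow> 'a \<Rightarrow> 'a \<Rightarrow> bool) \<Rightarrow> 'a \<Rightarrow> 'a \<Rightarrow> 'a \<Rightarrow> 'a \<Rightarrow> bool" where
  "cyclic4 \<gamma> p q r s \<longleftrightarrow>
     distinct [p, q, r, s] \<and> \<gamma> p q r \<and> \<gamma> q r s \<and> \<gamma> r s p \<and> \<gamma> s p q"

definition circularly_ordered_D_set ::
    "'a set \<Rightarrow> ('a \<Rightarrow> 'a \<Rightarrow> 'a \<Rightarrow> 'a \<Rightarrow> bool) \<Rightarrow> ('a \<Rightarrow> 'a \<Rightarrow> 'a \<Rightarrow> bool) \<Rightarrow> bool" where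
  "circularly_ordered_D_set \<Omega> D \<gamma> \<longleftrightarrow>
     D_set \<Omega> D \<and> circular_order \<Omega> \<gamma> \<and>
     (\<forall>x\<in>\<Omega>. \<forall>y\<in>\<Omega>. \<forall>z\<in>\<Omega>. \<forall>w\<in>\<Omega>.
        D x y z w \<longrightarrow> \<not> (cyclic4 \<gamma> x z y w \<or> cyclic4 \<gamma> w y z x))"

definition D_structure ::
    "'a set \<Rightarrow> ('a \<Rightarrow> 'a \<Rightarrow> 'a \<Rightarrow> 'a \<Rightarrow> bool) \<Rightarrow> ('a \<Rightarrow> 'a \<Rightarrow> 'a \<Rightarrow> bool) \<Rightarrow>
      ('a, symbol) rel_structure" where
  "D_structure \<Omega> D \<gamma> =
     \<lparr>universe = \<Omega>,
      arity = case_symbol 4 3,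
      rel = case_symbol (\<lambda>xs. D (xs ! 0) (xs ! 1) (xs ! 2) (xs ! 3))
                        (\<lambda>xs. \<gamma> (xs ! 0) (xs ! 1) (xs ! 2))\<rparr>"

text \<open>The new point is the first argument of $D$ and the last argument of $\gamma$.\<close>

definition zero_pos :: "symbol \<Rightarrow> nat" where
  "zero_pos = case_symbol 0 2"

lemma canonical_form_D_structure:
  "canonical_form zero_pos (C_structure \<Theta> C lt) (D_structure \<Omega> D \<gamma>) \<longleftrightarrow>
     (\<forall>x\<in>\<Theta>. \<forall>y\<in>\<Theta>. \<forall>z\<in>\<Theta>. C x y z \<longleftrightarrow> D None (Some x) (Some y) (Some z)) \<and>
     (\<forall>x\<in>\<Theta>. \<forall>y\<in>\<Theta>. lt x y \<longleftrightarrow> \<gamma> (Some x) (Some y) None)"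
proof -
  have all_symbol: "(\<forall>r. P r) \<longleftrightarrow> P Branching \<and> P Ordering" for P
    by (metis symbol.exhaust)
  have tup2: "(\<forall>xs. length xs = 2 \<and> set xs \<subseteq> \<Theta> \<longrightarrow> P xs) \<longleftrightarrow> (\<forall>x\<in>\<Theta>. \<forall>y\<in>\<Theta>. P [x, y])" for P
    by (auto simp: numeral_eq_Suc length_Suc_conv)
  have tup3: "(\<forall>xs. length xs = 3 \<and> set xs \<subseteq> \<Theta> \<longrightarrow> P xs) \<longleftrightarrow>
      (\<forall>x\<in>\<Theta>. \<forall>y\<in>\<Theta>. \<forall>z\<in>\<Theta>. P [x, y, z])" for P
    by (auto simp: numeral_eq_Suc length_Suc_conv)
  show ?thesis
    unfolding canonical_form_def all_symbol tuples_def C_structure_def D_structure_def zero_pos_def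
      Ball_def mem_Collect_eq rel_structure.simps symbol.case tup2 tup3
    by (simp add: numeral_eq_Suc)
qed

end

theory Submission
  imports Defs
begin

text \<open>
  Picture \<open>\<Theta>\<close> as the leaves of a tree and hang the new point \<open>None\<close> at the root: this extends $C$
  to \<open>\<Theta> \<union> {None}\<close>, and with \<open>None\<close> as the largest element the result is again an ordered C-set.
  Forgetting the root, let $D(wx;yz)$ mean that the paths from $w$ to $x$ and from $y$ to $z$ are
  disjoint, and close the linear order to a circle. Conversely, any point $r$ of a circularly
  ordered D-set determines an ordered C-set on the other points, from which $D$ and $\gamma$ can be
  recovered by the same formulas. Hence the automorphisms fixing \<open>None\<close> are those of \<open>\<Theta>\<close>.

  For transitivity, a back-and-forth argument extends the swap of \<open>None\<close> and $x$ to an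
  automorphism. All partial isomorphisms involved have \<open>None\<close> in their range, so each extension
  step, seen from \<open>None\<close> and from its preimage, is an instance of the extension property of \<open>\<Theta>\<close>.
\<close>

section \<open>Embeddings in terms of the relations\<close>

lemma ball_tuples2:
  assumes "arity M r = 2" "universe M = A"
  shows "(\<forall>xs\<in>tuples M r. P xs) \<longleftrightarrow> (\<forall>x\<in>A. \<forall>y\<in>A. P [x, y])"
proof -
  have "(\<forall>xs. length xs = 2 \<and> set xs \<subseteq> A \<longrightarrow> P xs) \<longleftrightarrow> (\<forall>x\<in>A. \<forall>y\<in>A. P [x, y])"
    by (auto simp: numeral_eq_Suc length_Suc_conv)
  then show ?thesis
    using assms by (simp add: tuples_def Ball_def)
qed

lemma ball_tuples3:
  assumes "arity M r = 3" "universe M = A"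
  shows "(\<forall>xs\<in>tuples M r. P xs) \<longleftrightarrow> (\<forall>x\<in>A. \<forall>y\<in>A. \<forall>z\<in>A. P [x, y, z])"
proof -
  have "(\<forall>xs. length xs = 3 \<and> set xs \<subseteq> A \<longrightarrow> P xs) \<longleftrightarrow> (\<forall>x\<in>A. \<forall>y\<in>A. \<forall>z\<in>A. P [x, y, z])"
    by (auto simp: numeral_eq_Suc length_Suc_conv)
  then show ?thesis
    using assms by (simp add: tuples_def Ball_def)
qed

lemma ball_tuples4:
  assumes "arity M r = 4" "universe M = A"
  shows "(\<forall>xs\<in>tuples M r. P xs) \<longleftrightarrow> (\<forall>w\<in>A. \<forall>x\<in>A. \<forall>y\<in>A. \<forall>z\<in>A. P [w, x, y, z])"
proof -
  have "(\<forall>xs. length xs = 4 \<and> set xs \<subseteq> A \<longrightarrow> P xs) \<longleftrightarrow> (\<forall>w\<in>A. \<forall>x\<in>A. \<forall>y\<in>A. \<forall>z\<in>A. P [w, x, y, z])"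
    by (auto simp: numeral_eq_Suc length_Suc_conv)
  then show ?thesis
    using assms by (simp add: tuples_def Ball_def)
qed

lemma all_symbol: "(\<forall>r. P r) \<longleftrightarrow> P Branching \<and> P Ordering"
  by (metis symbol.exhaust)

lemma C_structure_simps [simp]:
  "universe (C_structure \<Theta> C lt) = \<Theta>"
  "arity (C_structure \<Theta> C lt) = case_symbol 3 2"
  "rel (C_structure \<Theta> C lt) Branching [x, y, z] \<longleftrightarrow> C x y z"
  "rel (C_structure \<Theta> C lt) Ordering [x, y] \<longleftrightarrow> lt x y"
  by (simp_all add: C_structure_def)

lemma D_structure_simps [simp]:
  "universe (D_structure \<Omega> D \<gamma>) = \<Omega>"
  "arity (D_structure \<Omega> D \<gamma>) = case_symbol 4 3"
  "rel (D_structure \<Omega> D \<gamma>) Branching [w, x, y, z] \<longleftrightarrow> D w x y z"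
  "rel (D_structure \<Omega> D \<gamma>) Ordering [x, y, z] \<longleftrightarrow> \<gamma> x y z"
  by (simp_all add: D_structure_def numeral_eq_Suc)

text \<open>The value at the images stands on the left, opposite to \<open>embedding\<close>, so
  that the clauses rewrite images away; the instances of \<open>eq_commute\<close> do the
  turning.\<close>

lemma embedding_C_structure:
  "embedding (C_structure A C lt) (C_structure B C' lt') f \<longleftrightarrow>
     inj_on f A \<and> f ` A \<subseteq> B \<and>
     (\<forall>x\<in>A. \<forall>y\<in>A. \<forall>z\<in>A. C' (f x) (f y) (f z) \<longleftrightarrow> C x y z) \<and>
     (\<forall>x\<in>A. \<forall>y\<in>A. lt' (f x) (f y) \<longleftrightarrow> lt x y)"
  by (simp add: embedding_def all_symbol ball_tuples2 ball_tuples3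
      eq_commute[of "C x y z" for x y z] eq_commute[of "lt x y" for x y])

lemma embedding_D_structure:
  "embedding (D_structure A D \<gamma>) (D_structure B D' \<gamma>') f \<longleftrightarrow>
     inj_on f A \<and> f ` A \<subseteq> B \<and>
     (\<forall>w\<in>A. \<forall>x\<in>A. \<forall>y\<in>A. \<forall>z\<in>A. D' (f w) (f x) (f y) (f z) \<longleftrightarrow> D w x y z) \<and>
     (\<forall>x\<in>A. \<forall>y\<in>A. \<forall>z\<in>A. \<gamma>' (f x) (f y) (f z) \<longleftrightarrow> \<gamma> x y z)"
  by (simp add: embedding_def all_symbol ball_tuples3 ball_tuples4
      eq_commute[of "D w x y z" for w x y z] eq_commute[of "\<gamma> x y z" for x y z])

lemma substructure_C_structure [simp]:
  "substructure (C_structure \<Theta> C lt) F = C_structure F C lt"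
  by (simp add: substructure_def C_structure_def)

lemma Aut_C_structure_iff:
  "g \<in> Aut (C_structure \<Theta> C lt) \<longleftrightarrow>
     g permutes \<Theta> \<and>
     (\<forall>x\<in>\<Theta>. \<forall>y\<in>\<Theta>. \<forall>z\<in>\<Theta>. C (g x) (g y) (g z) \<longleftrightarrow> C x y z) \<and>
     (\<forall>x\<in>\<Theta>. \<forall>y\<in>\<Theta>. lt (g x) (g y) \<longleftrightarrow> lt x y)"
proof -
  have "inj_on g \<Theta> \<and> g ` \<Theta> = \<Theta>" if "g permutes \<Theta>"
    using that by (simp add: permutes_inj_on permutes_image)
  then show ?thesis
    unfolding Aut_def isomorphism_def embedding_C_structure mem_Collect_eq C_structure_simps
    by blast
qed

lemma Aut_D_structure_iff:
  "g \<in> Aut (D_structure \<Omega> D \<gamma>) \<longleftrightarrow>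
     g permutes \<Omega> \<and>
     (\<forall>w\<in>\<Omega>. \<forall>x\<in>\<Omega>. \<forall>y\<in>\<Omega>. \<forall>z\<in>\<Omega>. D (g w) (g x) (g y) (g z) \<longleftrightarrow> D w x y z) \<and>
     (\<forall>x\<in>\<Omega>. \<forall>y\<in>\<Omega>. \<forall>z\<in>\<Omega>. \<gamma> (g x) (g y) (g z) \<longleftrightarrow> \<gamma> x y z)"
proof -
  have "inj_on g \<Omega> \<and> g ` \<Omega> = \<Omega>" if "g permutes \<Omega>"
    using that by (simp add: permutes_inj_on permutes_image)
  then show ?thesis
    unfolding Aut_def isomorphism_def embedding_D_structure mem_Collect_eq D_structure_simps
    by blast
qed

lemma Aut_C_structureD:
  assumes "g \<in> Aut (C_structure \<Theta> C lt)"
  shows "g permutes \<Theta>"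
    "x \<in> \<Theta> \<Longrightarrow> y \<in> \<Theta> \<Longrightarrow> z \<in> \<Theta> \<Longrightarrow> C (g x) (g y) (g z) \<longleftrightarrow> C x y z"
    "x \<in> \<Theta> \<Longrightarrow> y \<in> \<Theta> \<Longrightarrow> lt (g x) (g y) \<longleftrightarrow> lt x y"
  using assms unfolding Aut_C_structure_iff by blast+

lemma Aut_D_structureD:
  assumes "g \<in> Aut (D_structure \<Omega> D \<gamma>)"
  shows "g permutes \<Omega>"
    "w \<in> \<Omega> \<Longrightarrow> x \<in> \<Omega> \<Longrightarrow> y \<in> \<Omega> \<Longrightarrow> z \<in> \<Omega> \<Longrightarrow> D (g w) (g x) (g y) (g z) \<longleftrightarrow> D w x y z"
    "x \<in> \<Omega> \<Longrightarrow> y \<in> \<Omega> \<Longrightarrow> z \<in> \<Omega> \<Longrightarrow> \<gamma> (g x) (g y) (g z) \<longleftrightarrow> \<gamma> x y z"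
  using assms unfolding Aut_D_structure_iff by blast+

lemma id_in_Aut_D_structure: "id \<in> Aut (D_structure \<Omega> D \<gamma>)"
  by (simp add: Aut_D_structure_iff permutes_id)

lemma comp_in_Aut_D_structure:
  assumes "g \<in> Aut (D_structure \<Omega> D \<gamma>)" "h \<in> Aut (D_structure \<Omega> D \<gamma>)"
  shows "g \<circ> h \<in> Aut (D_structure \<Omega> D \<gamma>)"
proof -
  have "h x \<in> \<Omega>" if "x \<in> \<Omega>" for x
    using assms(2) that permutes_in_image[of h \<Omega> x] by (simp add: Aut_D_structure_iff)
  then show ?thesis
    using assms unfolding Aut_D_structure_iff by (simp add: permutes_compose)
qed

section \<open>The axioms as rules\<close>

lemma C_setD:
  assumes "C_set \<Theta> C" "a \<in> \<Theta>" "b \<in> \<Theta>" "c \<in> \<Theta>"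
  shows "C a b c \<Longrightarrow> C a c b" "C a b c \<Longrightarrow> \<not> C b a c" "a \<noteq> b \<Longrightarrow> C a b b"
    "C a b c \<Longrightarrow> d \<in> \<Theta> \<Longrightarrow> C a d c \<or> C d b c"
proof -
  have ax: "(C a b c \<longrightarrow> C a c b) \<and> (C a b c \<longrightarrow> \<not> C b a c) \<and>
      (C a b c \<longrightarrow> C a d c \<or> C d b c) \<and> (a \<noteq> b \<longrightarrow> C a b b)" if "d \<in> \<Theta>" for d
    using assms(1)[unfolded C_set_def, THEN bspec, THEN bspec, THEN bspec, THEN bspec,
        OF assms(2-4) that] .
  show "C a b c \<Longrightarrow> C a c b" "C a b c \<Longrightarrow> \<not> C b a c" "a \<noteq> b \<Longrightarrow> C a b b"
    \<comment> \<open>All four axioms share the quantifier over \<open>d\<close>; those that do not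
      mention \<open>d\<close> are read off with \<open>d = c\<close>.\<close>
    using ax[OF assms(4)] by blast+
  show "C a b c \<Longrightarrow> d \<in> \<Theta> \<Longrightarrow> C a d c \<or> C d b c"
    using ax[of d] by blast
qed

lemma ordered_C_setD:
  assumes "ordered_C_set \<Theta> C lt" "a \<in> \<Theta>" "b \<in> \<Theta>" "c \<in> \<Theta>"
  shows "\<not> lt a a" "lt a b \<Longrightarrow> lt b c \<Longrightarrow> lt a c" "a \<noteq> b \<Longrightarrow> lt a b \<or> lt b a"
    "C a b c \<Longrightarrow> \<not> (lt b a \<and> lt a c)" "C a b c \<Longrightarrow> \<not> (lt c a \<and> lt a b)"
proof -
  have "irreflp_on \<Theta> lt" "transp_on \<Theta> lt" "totalp_on \<Theta> lt"
    and conv: "\<forall>x\<in>\<Theta>. \<forall>y\<in>\<Theta>. \<forall>z\<in>\<Theta>.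
        C x y z \<longrightarrow> \<not> ((lt y x \<and> lt x z) \<or> (lt z x \<and> lt x y))"
    using assms(1) by (simp_all add: ordered_C_set_def)
  then show "\<not> lt a a" "lt a b \<Longrightarrow> lt b c \<Longrightarrow> lt a c" "a \<noteq> b \<Longrightarrow> lt a b \<or> lt b a"
    using assms(2-4) by (auto dest: irreflp_onD transp_onD totalp_onD)
  show "C a b c \<Longrightarrow> \<not> (lt b a \<and> lt a c)" "C a b c \<Longrightarrow> \<not> (lt c a \<and> lt a b)"
    using conv[THEN bspec, THEN bspec, THEN bspec, OF assms(2-4)] by blast+
qed

lemma D_setD:
  assumes "D_set \<Omega> D" "a \<in> \<Omega>" "b \<in> \<Omega>" "c \<in> \<Omega>" "d \<in> \<Omega>"
  shows "D a b c d \<Longrightarrow> D b a c d" "D a b c d \<Longrightarrow> D c d a b" "D a b c d \<Longrightarrow> \<not> D a c b d"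
    "D a b c d \<Longrightarrow> v \<in> \<Omega> \<Longrightarrow> D v b c d \<or> D a b c v" "a \<noteq> c \<Longrightarrow> b \<noteq> c \<Longrightarrow> D a b c c"
proof -
  have ax: "(D a b c d \<longrightarrow> D b a c d \<and> D c d a b) \<and> (D a b c d \<longrightarrow> \<not> D a c b d) \<and>
      (D a b c d \<longrightarrow> (\<forall>v\<in>\<Omega>. D v b c d \<or> D a b c v)) \<and> (a \<noteq> c \<and> b \<noteq> c \<longrightarrow> D a b c c)"
    using assms(1)[unfolded D_set_def, THEN bspec, THEN bspec, THEN bspec, THEN bspec,
        OF assms(2-5)] .
  then show "D a b c d \<Longrightarrow> D b a c d" "D a b c d \<Longrightarrow> D c d a b" "D a b c d \<Longrightarrow> \<not> D a c b d"
    "a \<noteq> c \<Longrightarrow> b \<noteq> c \<Longrightarrow> D a b c c"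
    by blast+
  show "D a b c d \<Longrightarrow> v \<in> \<Omega> \<Longrightarrow> D v b c d \<or> D a b c v"
    using ax by blast
qed

lemma circular_orderD:
  assumes "circular_order \<Omega> \<gamma>" "a \<in> \<Omega>" "b \<in> \<Omega>" "c \<in> \<Omega>"
  shows "\<gamma> a b c \<Longrightarrow> \<gamma> b c a" "\<gamma> a b c \<Longrightarrow> \<not> \<gamma> a c b"
    "\<gamma> a b c \<Longrightarrow> \<gamma> a c d \<Longrightarrow> d \<in> \<Omega> \<Longrightarrow> \<gamma> a b d"
    "a \<noteq> b \<Longrightarrow> a \<noteq> c \<Longrightarrow> b \<noteq> c \<Longrightarrow> \<gamma> a b c \<or> \<gamma> a c b"
    "\<gamma> a b c \<Longrightarrow> a \<noteq> b \<and> a \<noteq> c \<and> b \<noteq> c"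
proof -
  note ax = assms(1)[unfolded circular_order_def]
  note cyc = ax[THEN conjunct1]
    and asym = ax[THEN conjunct2, THEN conjunct1]
    and trans = ax[THEN conjunct2, THEN conjunct2, THEN conjunct1]
    and total = ax[THEN conjunct2, THEN conjunct2, THEN conjunct2]
  show 1: "\<gamma> a b c \<Longrightarrow> \<gamma> b c a"
    using cyc[THEN bspec, THEN bspec, THEN bspec, OF assms(2-4)] by blast
  show 2: "\<gamma> a b c \<Longrightarrow> \<not> \<gamma> a c b"
    using asym[THEN bspec, THEN bspec, THEN bspec, OF assms(2-4)] by blast
  show "\<gamma> a b c \<Longrightarrow> \<gamma> a c d \<Longrightarrow> d \<in> \<Omega> \<Longrightarrow> \<gamma> a b d"
    using trans[THEN bspec, THEN bspec, THEN bspec, OF assms(2-4)] by blast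
  show "a \<noteq> b \<Longrightarrow> a \<noteq> c \<Longrightarrow> b \<noteq> c \<Longrightarrow> \<gamma> a b c \<or> \<gamma> a c b"
    using total[THEN bspec, THEN bspec, THEN bspec, OF assms(2-4)] by simp
  \<comment> \<open>Two equal arguments can be rotated to the front, giving a triple
    \<open>\<gamma> a a c\<close>. Its rotation \<open>\<gamma> a c a\<close> is what asymmetry
    forbids.\<close>
  show "\<gamma> a b c \<Longrightarrow> a \<noteq> b \<and> a \<noteq> c \<and> b \<noteq> c"
    using cyc asym assms(2-4) by metis
qed

lemma circularly_ordered_D_setD:
  assumes "circularly_ordered_D_set \<Omega> D \<gamma>"
  shows "D_set \<Omega> D" "circular_order \<Omega> \<gamma>"
    "a \<in> \<Omega> \<Longrightarrow> b \<in> \<Omega> \<Longrightarrow> c \<in> \<Omega> \<Longrightarrow> d \<in> \<Omega> \<Longrightarrow> D a b c d \<Longrightarrow> \<not> cyclic4 \<gamma> a c b d"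
    "a \<in> \<Omega> \<Longrightarrow> b \<in> \<Omega> \<Longrightarrow> c \<in> \<Omega> \<Longrightarrow> d \<in> \<Omega> \<Longrightarrow> D a b c d \<Longrightarrow> \<not> cyclic4 \<gamma> d b c a"
  using assms unfolding circularly_ordered_D_set_def by blast+

lemma ordered_C_setI:
  assumes "\<And>a b c. a \<in> \<Theta> \<Longrightarrow> b \<in> \<Theta> \<Longrightarrow> c \<in> \<Theta> \<Longrightarrow> C a b c \<Longrightarrow> C a c b"
    "\<And>a b c. a \<in> \<Theta> \<Longrightarrow> b \<in> \<Theta> \<Longrightarrow> c \<in> \<Theta> \<Longrightarrow> C a b c \<Longrightarrow> \<not> C b a c"
    "\<And>a b c d. a \<in> \<Theta> \<Longrightarrow> b \<in> \<Theta> \<Longrightarrow> c \<in> \<Theta> \<Longrightarrow> d \<in> \<Theta> \<Longrightarrow> C a b c \<Longrightarrow> C a d c \<or> C d b c"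
    "\<And>a b. a \<in> \<Theta> \<Longrightarrow> b \<in> \<Theta> \<Longrightarrow> a \<noteq> b \<Longrightarrow> C a b b"
    "\<And>a. a \<in> \<Theta> \<Longrightarrow> \<not> lt a a"
    "\<And>a b c. a \<in> \<Theta> \<Longrightarrow> b \<in> \<Theta> \<Longrightarrow> c \<in> \<Theta> \<Longrightarrow> lt a b \<Longrightarrow> lt b c \<Longrightarrow> lt a c"
    "\<And>a b. a \<in> \<Theta> \<Longrightarrow> b \<in> \<Theta> \<Longrightarrow> a \<noteq> b \<Longrightarrow> lt a b \<or> lt b a"
    "\<And>a b c. a \<in> \<Theta> \<Longrightarrow> b \<in> \<Theta> \<Longrightarrow> c \<in> \<Theta> \<Longrightarrow> C a b c \<Longrightarrow>
      \<not> (lt b a \<and> lt a c) \<and> \<not> (lt c a \<and> lt a b)"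
  shows "ordered_C_set \<Theta> C lt"
proof -
  have "C_set \<Theta> C"
    unfolding C_set_def by (intro ballI conjI impI; rule assms(1-4); assumption)
  moreover have "irreflp_on \<Theta> lt" "transp_on \<Theta> lt" "totalp_on \<Theta> lt"
    by (rule irreflp_onI transp_onI totalp_onI, rule assms; assumption)+
  ultimately show ?thesis
    using assms(8) by (simp add: ordered_C_set_def)
qed

lemma ordered_C_set_subset:
  assumes "ordered_C_set A C lt" "B \<subseteq> A"
  shows "ordered_C_set B C lt"
proof -
  note ax = assms(1)[unfolded ordered_C_set_def C_set_def]
  have "C_set B C"
    unfolding C_set_def
    by (intro ballI,
        rule ax[THEN conjunct1, THEN bspec, THEN bspec, THEN bspec, THEN bspec])
      (use assms(2) in blast)+
  moreover have "irreflp_on B lt" "transp_on B lt" "totalp_on B lt"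
    using ax assms(2) irreflp_on_subset transp_on_subset totalp_on_subset by metis+
  moreover have "\<forall>x\<in>B. \<forall>y\<in>B. \<forall>z\<in>B. C x y z \<longrightarrow> \<not> ((lt y x \<and> lt x z) \<or> (lt z x \<and> lt x y))"
    using ordered_C_setD(4,5)[OF assms(1)] assms(2) by (metis subsetD)
  ultimately show ?thesis
    by (simp add: ordered_C_set_def)
qed

text \<open>The axioms quantify over the universe only. Pulled back from the image to
  \<open>A\<close>, they turn into the axioms for \<open>A\<close>, because \<open>f\<close>
  preserves and reflects \<open>C\<close>, \<open>lt\<close> and equality.\<close>

lemma ordered_C_set_image:
  assumes "ordered_C_set A C lt" "embedding (C_structure A C lt) (C_structure B C' lt') f"
  shows "ordered_C_set (f ` A) C' lt'"
proof -
  have "C' (f x) (f y) (f z) \<longleftrightarrow> C x y z" "lt' (f x) (f y) \<longleftrightarrow> lt x y" "f x = f y \<longleftrightarrow> x = y"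
    if "x \<in> A" "y \<in> A" "z \<in> A" for x y z
    using assms(2) that by (auto simp: embedding_C_structure dest: inj_onD)
  then have "ordered_C_set (f ` A) C' lt' \<longleftrightarrow> ordered_C_set A C lt"
    unfolding ordered_C_set_def C_set_def irreflp_on_def transp_on_def totalp_on_def ball_simps
    by (simp cong: ball_cong_simp)
  with assms(1) show ?thesis by blast
qed

section \<open>The generic ordered C-set\<close>

text \<open>Each axiom is universal in at most four points, so subsets \<open>{a, b, c, d}\<close>
  suffice. Axioms in fewer points use the same sets with a point repeated.\<close>

lemma ordered_C_set_if_finite_subsets:
  assumes "\<And>F. finite F \<Longrightarrow> F \<subseteq> \<Theta> \<Longrightarrow> ordered_C_set F C lt"
  shows "ordered_C_set \<Theta> C lt"
proof -
  have sub: "ordered_C_set {a, b, c, d} C lt"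
    if "a \<in> \<Theta>" "b \<in> \<Theta>" "c \<in> \<Theta>" "d \<in> \<Theta>" for a b c d
    using that by (intro assms) auto
  then have C: "C_set {a, b, c, d} C"
    if "a \<in> \<Theta>" "b \<in> \<Theta>" "c \<in> \<Theta>" "d \<in> \<Theta>" for a b c d
    using that by (simp add: ordered_C_set_def)
  have mem: "a \<in> {a, b, c, d}" "b \<in> {a, b, c, d}" "c \<in> {a, b, c, d}" "d \<in> {a, b, c, d}" for a b c d :: 'a
    by simp_all
  show ?thesis
  proof (rule ordered_C_setI)
    fix a b c d assume \<Theta>: "a \<in> \<Theta>" "b \<in> \<Theta>" "c \<in> \<Theta>" "d \<in> \<Theta>"
    show "C a b c \<Longrightarrow> C a d c \<or> C d b c"
      using C_setD(4)[OF C[OF \<Theta>] mem(1-3)] mem(4) by blast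
  next
    fix a b c assume \<Theta>: "a \<in> \<Theta>" "b \<in> \<Theta>" "c \<in> \<Theta>"
    note CD = C_setD[OF C[OF \<Theta> \<Theta>(3)] mem(1-3)]
    show "C a b c \<Longrightarrow> C a c b" "C a b c \<Longrightarrow> \<not> C b a c"
      by (fact CD(1), fact CD(2))
    note ltD = ordered_C_setD[OF sub[OF \<Theta> \<Theta>(3)] mem(1-3)]
    show "lt a b \<Longrightarrow> lt b c \<Longrightarrow> lt a c" by (fact ltD(2))
    show "\<not> (lt b a \<and> lt a c) \<and> \<not> (lt c a \<and> lt a b)" if "C a b c"
      using ltD(4,5)[OF that] by blast
  next
    fix a b assume \<Theta>: "a \<in> \<Theta>" "b \<in> \<Theta>"
    show "a \<noteq> b \<Longrightarrow> C a b b"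
      by (fact C_setD(3)[OF C[OF \<Theta> \<Theta>(2) \<Theta>(2)] mem(1-3)])
    show "a \<noteq> b \<Longrightarrow> lt a b \<or> lt b a"
      by (fact ordered_C_setD(3)[OF sub[OF \<Theta> \<Theta>(2) \<Theta>(2)] mem(1-3)])
  next
    fix a assume \<Theta>: "a \<in> \<Theta>"
    show "\<not> lt a a"
      by (fact ordered_C_setD(1)[OF sub[OF \<Theta> \<Theta> \<Theta> \<Theta>] mem(1-3)])
  qed
qed

text \<open>The limit is only known through its age: every finite substructure is an isomorphic copy
  of a finite ordered C-set.\<close>

lemma generic_ordered_C_set_is_ordered_C_set:
  assumes "generic_ordered_C_set \<Theta> C lt"
  shows "ordered_C_set \<Theta> C lt"
proof (rule ordered_C_set_if_finite_subsets)
  fix F assume "finite F" "F \<subseteq> \<Theta>"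
  with assms obtain A f where "A \<in> finite_ordered_C_sets" "isomorphism A (C_structure F C lt) f"
    unfolding generic_ordered_C_set_def Fraisse_limit_def
    by (metis C_structure_simps(1) substructure_C_structure)
  then show "ordered_C_set F C lt"
    unfolding finite_ordered_C_sets_def isomorphism_def
    using ordered_C_set_image by fastforce
qed

lemma C_structure_in_finite_ordered_C_sets:
  "finite A \<Longrightarrow> ordered_C_set A C lt \<Longrightarrow> C_structure A C lt \<in> finite_ordered_C_sets"
  unfolding finite_ordered_C_sets_def by blast

text \<open>The members of the class live on \<open>nat\<close>, so \<open>A\<close> is first copied
  along an injection \<open>h\<close>, with inverse \<open>k\<close> on \<open>A\<close>. The type
  of \<open>A\<close> is left free because the sets embedded later consist of elements of
  \<open>'a option\<close>.\<close>

lemma generic_ordered_C_set_universal: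
  fixes A :: "'b set" and C :: "'a \<Rightarrow> 'a \<Rightarrow> 'a \<Rightarrow> bool"
  assumes "generic_ordered_C_set \<Theta> C lt" "finite A" "ordered_C_set A C' lt'"
  shows "\<exists>f. embedding (C_structure A C' lt') (C_structure \<Theta> C lt) f"
proof -
  obtain h :: "'b \<Rightarrow> nat" where h: "inj_on h A"
    using finite_imp_inj_to_nat_seg[OF assms(2)] by blast
  define k where "k = inv_into A h"
  have k: "k (h a) = a" if "a \<in> A" for a
    using h that by (simp add: k_def)
  let ?B = "C_structure (h ` A) (\<lambda>x y z. C' (k x) (k y) (k z)) (\<lambda>x y. lt' (k x) (k y))"
  have emb: "embedding (C_structure A C' lt') ?B h"
    unfolding embedding_C_structure using h k by simp
  have "?B \<in> finite_ordered_C_sets"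
    using assms(2) by (intro C_structure_in_finite_ordered_C_sets ordered_C_set_image[OF assms(3) emb]) simp
  moreover have "\<forall>B\<in>finite_ordered_C_sets. \<exists>f. embedding B (C_structure \<Theta> C lt) f"
    using assms(1) by (simp add: generic_ordered_C_set_def Fraisse_limit_def)
  ultimately obtain e where "embedding ?B (C_structure \<Theta> C lt) e"
    by blast
  then have e: "inj_on e (h ` A)" "e ` h ` A \<subseteq> \<Theta>"
    "\<And>x y z. x \<in> A \<Longrightarrow> y \<in> A \<Longrightarrow> z \<in> A \<Longrightarrow> C (e (h x)) (e (h y)) (e (h z)) \<longleftrightarrow> C' x y z"
    "\<And>x y. x \<in> A \<Longrightarrow> y \<in> A \<Longrightarrow> lt (e (h x)) (e (h y)) \<longleftrightarrow> lt' x y"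
    unfolding embedding_C_structure by (simp_all add: k)
  have "embedding (C_structure A C' lt') (C_structure \<Theta> C lt) (e \<circ> h)"
    using e comp_inj_on[OF h e(1)] by (auto simp: embedding_C_structure)
  then show ?thesis by blast
qed

lemma homogeneousD:
  assumes "homogeneous M" "finite F" "F \<subseteq> universe M" "G \<subseteq> universe M"
    "isomorphism (substructure M F) (substructure M G) f"
  obtains g where "g \<in> Aut M" "\<forall>x\<in>F. g x = f x"
  using assms(1)[unfolded homogeneous_def, rule_format, of F G f] assms(2-5) by blast

text \<open>The usual extension property: universality gives some embedding \<open>e\<close> of
  \<open>A\<close>, and homogeneity gives an automorphism \<open>g\<close> that corrects
  \<open>e\<close> on \<open>B\<close>. The required map is \<open>g \<circ> e\<close>.\<close>

lemma generic_ordered_C_set_extension: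
  fixes A :: "'b set" and C :: "'a \<Rightarrow> 'a \<Rightarrow> 'a \<Rightarrow> bool"
  assumes gen: "generic_ordered_C_set \<Theta> C lt"
    and "finite A" "ordered_C_set A C' lt'" "B \<subseteq> A"
    and f: "embedding (C_structure B C' lt') (C_structure \<Theta> C lt) f"
  obtains h where "embedding (C_structure A C' lt') (C_structure \<Theta> C lt) h" "\<forall>b\<in>B. h b = f b"
proof -
  obtain e where "embedding (C_structure A C' lt') (C_structure \<Theta> C lt) e"
    using generic_ordered_C_set_universal[OF assms(1-3)] by blast
  then have e: "inj_on e A" "\<And>x. x \<in> A \<Longrightarrow> e x \<in> \<Theta>"
    "\<And>x y z. x \<in> A \<Longrightarrow> y \<in> A \<Longrightarrow> z \<in> A \<Longrightarrow> C (e x) (e y) (e z) \<longleftrightarrow> C' x y z"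
    "\<And>x y. x \<in> A \<Longrightarrow> y \<in> A \<Longrightarrow> lt (e x) (e y) \<longleftrightarrow> lt' x y"
    unfolding embedding_C_structure by blast+
  have f': "inj_on f B" "\<And>x. x \<in> B \<Longrightarrow> f x \<in> \<Theta>"
    "\<And>x y z. x \<in> B \<Longrightarrow> y \<in> B \<Longrightarrow> z \<in> B \<Longrightarrow> C (f x) (f y) (f z) \<longleftrightarrow> C' x y z"
    "\<And>x y. x \<in> B \<Longrightarrow> y \<in> B \<Longrightarrow> lt (f x) (f y) \<longleftrightarrow> lt' x y"
    using f unfolding embedding_C_structure by blast+
  define k where "k = inv_into B e"
  have BA: "b \<in> A" if "b \<in> B" for b using that \<open>B \<subseteq> A\<close> by blast
  have "inj_on e B"
    using e(1) \<open>B \<subseteq> A\<close> by (rule inj_on_subset)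
  then have k: "k (e b) = b" if "b \<in> B" for b
    using that by (simp add: k_def)
  \<comment> \<open>Both \<open>e\<close> and \<open>f\<close> copy \<open>B\<close> into
    \<open>\<Theta>\<close>; going back along the one and forth along the other is the finite
    isomorphism to be extended by homogeneity.\<close>
  have "isomorphism (C_structure (e ` B) C lt) (C_structure (f ` B) C lt) (f \<circ> k)"
    unfolding isomorphism_def embedding_C_structure C_structure_simps ball_simps
  proof (intro conjI ballI)
    show "inj_on (f \<circ> k) (e ` B)"
      using f'(1) k by (auto intro!: inj_onI dest: inj_onD)
    show "(f \<circ> k) ` e ` B \<subseteq> f ` B" "(f \<circ> k) ` e ` B = f ` B"
      using k by (auto simp: image_iff)
  qed (simp_all add: k BA e f')
  moreover have "homogeneous (C_structure \<Theta> C lt)"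
    using gen by (simp add: generic_ordered_C_set_def Fraisse_limit_def)
  moreover have "finite (e ` B)" "e ` B \<subseteq> \<Theta>" "f ` B \<subseteq> \<Theta>"
    using finite_subset[OF \<open>B \<subseteq> A\<close> \<open>finite A\<close>] e(2) f'(2) BA by auto
  ultimately obtain g where "g \<in> Aut (C_structure \<Theta> C lt)" and ge: "\<forall>x\<in>e ` B. g x = (f \<circ> k) x"
    using homogeneousD[of "C_structure \<Theta> C lt" "e ` B" "f ` B" "f \<circ> k"]
    unfolding C_structure_simps substructure_C_structure by metis
  then have "g permutes \<Theta>"
    and g: "\<And>x y z. x \<in> \<Theta> \<Longrightarrow> y \<in> \<Theta> \<Longrightarrow> z \<in> \<Theta> \<Longrightarrow> C (g x) (g y) (g z) \<longleftrightarrow> C x y z"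
    "\<And>x y. x \<in> \<Theta> \<Longrightarrow> y \<in> \<Theta> \<Longrightarrow> lt (g x) (g y) \<longleftrightarrow> lt x y"
    unfolding Aut_C_structure_iff by blast+
  then have "inj g" and g\<Theta>: "\<And>x. x \<in> \<Theta> \<Longrightarrow> g x \<in> \<Theta>"
    by (simp_all only: permutes_inj permutes_in_image)
  show thesis
  proof
    show "embedding (C_structure A C' lt') (C_structure \<Theta> C lt) (g \<circ> e)"
      unfolding embedding_C_structure
    proof (intro conjI ballI)
      show "inj_on (g \<circ> e) A"
        using e(1) \<open>inj g\<close> by (auto intro: comp_inj_on inj_on_subset)
    qed (use e(2) g\<Theta> in \<open>auto simp: e g\<close>)
    show "\<forall>b\<in>B. (g \<circ> e) b = f b"
      using ge by (simp add: k)
  qed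
qed

section \<open>C-relations and D-relations\<close>

text \<open>In the tree, two paths between leaves are disjoint exactly if one of them has both
  leaves of the other outside the subtree that it spans. The two disjuncts say which path this
  is.\<close>

definition D_of :: "('a \<Rightarrow> 'a \<Rightarrow> 'a \<Rightarrow> bool) \<Rightarrow> 'a \<Rightarrow> 'a \<Rightarrow> 'a \<Rightarrow> 'a \<Rightarrow> bool" where
  "D_of C w x y z \<longleftrightarrow> C w y z \<and> C x y z \<or> C y w x \<and> C z w x"

definition circular_of :: "('a \<Rightarrow> 'a \<Rightarrow> bool) \<Rightarrow> 'a \<Rightarrow> 'a \<Rightarrow> 'a \<Rightarrow> bool" where
  "circular_of lt x y z \<longleftrightarrow> lt x y \<and> lt y z \<or> lt y z \<and> lt z x \<or> lt z x \<and> lt x y"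

lemma D_set_D_of:
  assumes "C_set \<Omega> C"
  shows "D_set \<Omega> (D_of C)"
proof -
  note 1 = C_setD(1)[OF assms] and 2 = C_setD(2)[OF assms]
    and 3 = C_setD(4)[OF assms] and 4 = C_setD(3)[OF assms]
  show ?thesis
    unfolding D_set_def
  proof (intro ballI conjI impI)
    fix w x y z assume mem: "w \<in> \<Omega>" "x \<in> \<Omega>" "y \<in> \<Omega>" "z \<in> \<Omega>"
    {
      assume "D_of C w x y z"
      then show "D_of C x w y z" "D_of C y z w x" "\<not> D_of C w y x z"
        using mem 1 2 unfolding D_of_def by metis+
    next
      \<comment> \<open>One pair lies in a subtree that avoids the other pair. By (C3), either
        \<open>v\<close> is outside this subtree as well and can replace a point of the other pair,
        or \<open>v\<close> can replace a point of the pair inside.\<close>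
      fix v assume "D_of C w x y z" "v \<in> \<Omega>"
      then show "D_of C v x y z \<or> D_of C w x y v"
        using mem 1 3 unfolding D_of_def by metis
    next
      assume "w \<noteq> y \<and> x \<noteq> y"
      then show "D_of C w x y y"
        using mem 4 unfolding D_of_def by blast
    }
  qed
qed

lemma circular_order_circular_of:
  assumes "irreflp_on \<Omega> lt" "transp_on \<Omega> lt" "totalp_on \<Omega> lt"
  shows "circular_order \<Omega> (circular_of lt)"
proof -
  have irr: "\<not> lt a a" if "a \<in> \<Omega>" for a
    using assms(1) that by (simp add: irreflp_on_def)
  have tr: "lt a c" if "lt a b" "lt b c" "a \<in> \<Omega>" "b \<in> \<Omega>" "c \<in> \<Omega>" for a b c
    using assms(2) that unfolding transp_on_def by blast
  have tot: "lt a b \<or> lt b a" if "a \<noteq> b" "a \<in> \<Omega>" "b \<in> \<Omega>" for a b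
    using assms(3) that unfolding totalp_on_def by blast
  show ?thesis
    unfolding circular_order_def circular_of_def
    apply (intro conjI ballI impI)
    subgoal by blast
    subgoal using irr tr by metis
    subgoal using irr tr by metis
    subgoal using tot by (metis distinct_length_2_or_more)
    done
qed

lemma circularly_ordered_D_set_of:
  assumes "ordered_C_set \<Omega> C lt"
  shows "circularly_ordered_D_set \<Omega> (D_of C) (circular_of lt)"
proof -
  note irr = ordered_C_setD(1)[OF assms] and tr = ordered_C_setD(2)[OF assms]
    and conv = ordered_C_setD(4,5)[OF assms]
  have C: "C_set \<Omega> C"
    using assms by (simp add: ordered_C_set_def)
  have lt: "irreflp_on \<Omega> lt" "transp_on \<Omega> lt" "totalp_on \<Omega> lt"
    using assms by (simp_all add: ordered_C_set_def)
  have "\<not> (cyclic4 (circular_of lt) x z y w \<or> cyclic4 (circular_of lt) w y z x)"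
    if mem: "x \<in> \<Omega>" "y \<in> \<Omega>" "z \<in> \<Omega>" "w \<in> \<Omega>" and D: "D_of C x y z w" for x y z w
  proof
    assume "cyclic4 (circular_of lt) x z y w \<or> cyclic4 (circular_of lt) w y z x"
    \<comment> \<open>These are the eight linear orders of the four points in which the pairs
      \<open>x\<close>, \<open>y\<close> and \<open>z\<close>, \<open>w\<close> alternate.\<close>
    then have "lt x z \<and> lt z y \<and> lt y w \<or> lt z y \<and> lt y w \<and> lt w x \<or>
        lt y w \<and> lt w x \<and> lt x z \<or> lt w x \<and> lt x z \<and> lt z y \<or>
        lt w y \<and> lt y z \<and> lt z x \<or> lt y z \<and> lt z x \<and> lt x w \<or>
        lt z x \<and> lt x w \<and> lt w y \<or> lt x w \<and> lt w y \<and> lt y z"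
      unfolding cyclic4_def circular_of_def using mem irr tr by metis
    \<comment> \<open>The compatibility of \<open>C\<close> with \<open>lt\<close> gives one
      disjunct for each disjunct of \<open>D_of\<close>: one of the two pairs has no point of the
      other between its members.\<close>
    moreover have "\<not> (lt z x \<and> lt x w) \<and> \<not> (lt w x \<and> lt x z) \<and>
          \<not> (lt z y \<and> lt y w) \<and> \<not> (lt w y \<and> lt y z) \<or>
        \<not> (lt x z \<and> lt z y) \<and> \<not> (lt y z \<and> lt z x) \<and>
          \<not> (lt x w \<and> lt w y) \<and> \<not> (lt y w \<and> lt w x)"
      using D conv mem unfolding D_of_def by metis
    ultimately show False by blast
  qed
  then show ?thesis
    unfolding circularly_ordered_D_set_def
    using D_set_D_of[OF C] circular_order_circular_of[OF lt] by blast
qed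

section \<open>Recovering a circularly ordered D-set from one of its points\<close>

text \<open>By (D3) the root \<open>r\<close> can be substituted into one of the two pairs
  (\<open>split\<close>), and two rooted statements about the same pair can be joined by removing
  the root (\<open>merge\<close>). No point need differ from \<open>r\<close>.\<close>

lemma D_set_rooted:
  assumes D: "D_set \<Omega> D" and mem: "r \<in> \<Omega>" "w \<in> \<Omega>" "x \<in> \<Omega>" "y \<in> \<Omega>" "z \<in> \<Omega>"
  shows "D w x y z \<longleftrightarrow> D_of (D r) w x y z"
proof -
  note 1 = D_setD(1,2)[OF D] and 2 = D_setD(3)[OF D] and 3 = D_setD(4)[OF D]
  have sym: "D a b d c" if "D a b c d" "a \<in> \<Omega>" "b \<in> \<Omega>" "c \<in> \<Omega>" "d \<in> \<Omega>" for a b c d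
    using 1(2)[of a b c d] 1(1)[of c d a b] 1(2)[of d c a b] that by blast
  have split: "D r b c d \<or> D r c a b"
    if "D a b c d" "a \<in> \<Omega>" "b \<in> \<Omega>" "c \<in> \<Omega>" "d \<in> \<Omega>" for a b c d
    using 3[of a b c d r] 1(2)[of a b c r] 1(1)[of c r a b] that mem(1) by blast
  \<comment> \<open>If the conclusion failed, (D3) would put \<open>a\<close>, respectively
    \<open>b\<close>, in place of \<open>d\<close> in the two assumptions. The results contradict
    (D2).\<close>
  have merge: "D a b c d"
    if "D r a c d" "D r b c d" "a \<in> \<Omega>" "b \<in> \<Omega>" "c \<in> \<Omega>" "d \<in> \<Omega>" for a b c d
  proof (rule ccontr)
    assume "\<not> D a b c d"
    then have "D r b c a" "D r a c b"
      using 3[of r b c d a] 3[of r a c d b] 1(1)[of b a c d] that mem(1) by blast+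
    then have "D r b a c" "D r a b c"
      using sym that(3-6) mem(1) by blast+
    then show False
      using 2[of r b a c] that(3-6) mem(1) by blast
  qed
  show ?thesis
    unfolding D_of_def
  proof
    assume wxyz: "D w x y z"
    then have "D x w y z" "D w x z y" "D x w z y"
      using 1(1) sym mem by blast+
    \<comment> \<open>Splitting all four ways of listing the pairs gives \<open>(p \<or> s) \<and>
      (q \<or> s) \<and> (p \<or> t) \<and> (q \<or> t)\<close>, which is
      \<open>p \<and> q \<or> s \<and> t\<close>, the shape of \<open>D_of\<close>.\<close>
    with wxyz have "D r x y z \<or> D r y w x" "D r w y z \<or> D r y x w"
        "D r x z y \<or> D r z w x" "D r w z y \<or> D r z x w"
      using split mem by blast+
    moreover have "D r a c b \<longleftrightarrow> D r a b c" if "a \<in> \<Omega>" "b \<in> \<Omega>" "c \<in> \<Omega>" for a b c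
      using sym mem(1) that by blast
    ultimately show "D r w y z \<and> D r x y z \<or> D r y w x \<and> D r z w x"
      using mem by blast
  next
    assume "D r w y z \<and> D r x y z \<or> D r y w x \<and> D r z w x"
    then show "D w x y z"
      using merge[of w y z x] merge[of y w x z] 1(2)[of y z w x] mem by blast
  qed
qed

text \<open>When the root occurs a second time, the axioms alone decide \<open>D\<close>. A
  comparison of two rooted relations is therefore only needed at points other than the root.\<close>

lemma D_set_degenerate:
  assumes D: "D_set \<Omega> D" and mem: "r \<in> \<Omega>" "x \<in> \<Omega>" "y \<in> \<Omega>"
  shows "D r r x y \<longleftrightarrow> x \<noteq> r \<and> y \<noteq> r" "\<not> D r x r y" "\<not> D r x y r"
proof -
  note 1 = D_setD(1,2)[OF D] and 2 = D_setD(3)[OF D] and 4 = D_setD(5)[OF D]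
  have pos: "D r r a b" if "a \<noteq> r" "b \<noteq> r" "a \<in> \<Omega>" "b \<in> \<Omega>" for a b
    using 4[of a b r r] 1(2)[of a b r r] that mem(1) by blast
  have neg: "\<not> D r a r b" if "a \<in> \<Omega>" "b \<in> \<Omega>" for a b
  proof
    assume rarb: "D r a r b"
    then have "\<not> D r r a b"
      using 2 that mem(1) by blast
    with pos that have "a = r \<or> b = r" by blast
    \<comment> \<open>Exchanging the two equal middle arguments changes nothing, so this instance of
      (D2) denies its own hypothesis.\<close>
    moreover have "D r r r c \<Longrightarrow> \<not> D r r r c" if "c \<in> \<Omega>" for c
      using 2 that mem(1) by blast
    moreover have "D r r r a" if "b = r"
      using 1(2)[of r a r r] rarb that \<open>a \<in> \<Omega>\<close> mem(1) by blast
    ultimately show False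
      using rarb that by blast
  qed
  show "\<not> D r x r y" using neg mem by blast
  show neg': "\<not> D r x y r"
    using neg[of y x] 1(2)[of r x y r] 1(1)[of y r r x] mem by blast
  show "D r r x y \<longleftrightarrow> x \<noteq> r \<and> y \<noteq> r"
    using pos[of x y] neg[of r y] 1(2)[of r r x r] 1(1)[of x r r r] neg[of x r] mem by blast
qed

text \<open>Transitivity of a circular order keeps its first argument fixed. The triples are rotated
  to start with \<open>b\<close> for the first claim and with \<open>r\<close> for the
  second.\<close>

lemma circular_order_cut:
  assumes \<gamma>: "circular_order \<Omega> \<gamma>" and cut: "\<gamma> a b r" "\<gamma> b c r"
    and mem: "a \<in> \<Omega>" "b \<in> \<Omega>" "c \<in> \<Omega>" "r \<in> \<Omega>"
  shows "\<gamma> a b c" "\<gamma> a c r"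
proof -
  note 1 = circular_orderD(1)[OF \<gamma>] and 3 = circular_orderD(3)[OF \<gamma>]
  show "\<gamma> a b c"
    using 1[of a b r] 1[of b r a] 3[of b c r a] 1[of b c a] 1[of c a b] cut mem by blast
  show "\<gamma> a c r"
    using 1[of a b r] 1[of b r a] 1[of b c r] 1[of c r b] 3[of r a b c] 1[of r a c] cut mem
    by blast
qed

text \<open>The circle is cut open just after \<open>r\<close>, so that \<open>r\<close> becomes the
  largest point, as \<open>None\<close> does under \<open>add_top\<close>.\<close>

definition cut :: "('a \<Rightarrow> 'a \<Rightarrow> 'a \<Rightarrow> bool) \<Rightarrow> 'a \<Rightarrow> 'a \<Rightarrow> 'a \<Rightarrow> bool" where
  "cut \<gamma> r x y \<longleftrightarrow> \<gamma> x y r \<or> y = r \<and> x \<noteq> r"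

text \<open>Chains of the cut order are positively oriented, and distinct points are comparable. If
  \<open>\<gamma> x y z\<close>, then no listing of the opposite orientation is a chain, which
  leaves only the disjuncts of \<open>circular_of\<close>.\<close>

lemma circular_order_rooted:
  assumes \<gamma>: "circular_order \<Omega> \<gamma>" and mem: "r \<in> \<Omega>" "x \<in> \<Omega>" "y \<in> \<Omega>" "z \<in> \<Omega>"
  shows "\<gamma> x y z \<longleftrightarrow> circular_of (cut \<gamma> r) x y z"
proof -
  note 1 = circular_orderD(1)[OF \<gamma>] and 2 = circular_orderD(2)[OF \<gamma>]
    and 4 = circular_orderD(4)[OF \<gamma>]
    and ne = circular_orderD(5)[OF \<gamma>]
  have cut_chain: "\<gamma> a b c"
    if "cut \<gamma> r a b" "cut \<gamma> r b c" "a \<in> \<Omega>" "b \<in> \<Omega>" "c \<in> \<Omega>" for a b c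
    using that ne[of b c r] circular_order_cut[OF \<gamma>, of a b r c] mem(1)
    unfolding cut_def by blast
  have cut_total: "cut \<gamma> r a b \<or> cut \<gamma> r b a" if "a \<noteq> b" "a \<in> \<Omega>" "b \<in> \<Omega>" for a b
    using that 1[of a r b] 1[of r b a] 4[of a b r] mem(1) unfolding cut_def by blast
  show ?thesis
  proof
    assume xyz: "\<gamma> x y z"
    then have "x \<noteq> y" "x \<noteq> z" "y \<noteq> z" using ne mem by blast+
    moreover have "\<not> \<gamma> x z y" "\<not> \<gamma> y x z" "\<not> \<gamma> z y x"
      using xyz 2[of x y z] 1[of y x z] 1[of z y x] 1[of y x z] mem by blast+
    ultimately show "circular_of (cut \<gamma> r) x y z"
      unfolding circular_of_def
      using cut_total[of x y] cut_total[of y z] cut_total[of x z]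
        cut_chain[of x z y] cut_chain[of y x z] cut_chain[of z y x] mem by blast
  next
    assume "circular_of (cut \<gamma> r) x y z"
    then show "\<gamma> x y z"
      unfolding circular_of_def
      using cut_chain[of x y z] cut_chain[of y z x] cut_chain[of z x y]
        1[of y z x] 1[of z x y] mem by blast
  qed
qed

lemma ordered_C_set_rooted:
  assumes \<Omega>: "circularly_ordered_D_set \<Omega> D \<gamma>" and r: "r \<in> \<Omega>"
  shows "ordered_C_set (\<Omega> - {r}) (D r) (\<lambda>x y. \<gamma> x y r)"
proof -
  have D: "D_set \<Omega> D" and \<gamma>: "circular_order \<Omega> \<gamma>"
    using circularly_ordered_D_setD[OF \<Omega>] by auto
  note D1 = D_setD(1,2)[OF D] and D2 = D_setD(3)[OF D] and D3 = D_setD(4)[OF D]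
    and D4 = D_setD(5)[OF D]
  note g1 = circular_orderD(1)[OF \<gamma>] and g4 = circular_orderD(4)[OF \<gamma>]
    and ne = circular_orderD(5)[OF \<gamma>]
  \<comment> \<open>A chain in the order cut at \<open>r\<close> closes up to a circle through
    \<open>r\<close>. Both rotations are stated because the compatibility axiom for \<open>D\<close>
    excludes one of each form.\<close>
  have cyc: "cyclic4 \<gamma> r a b c" "cyclic4 \<gamma> a b c r"
    if "\<gamma> a b r" "\<gamma> b c r" "a \<in> \<Omega>" "b \<in> \<Omega>" "c \<in> \<Omega>" for a b c
  proof -
    have "\<gamma> a b c" "\<gamma> a c r"
      using circular_order_cut[OF \<gamma> that(1,2)] that r by blast+
    moreover have "\<gamma> r a b" "\<gamma> c r a"
      using that \<open>\<gamma> a c r\<close> g1[of a b r] g1[of b r a] g1[of a c r] r by blast+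
    moreover have "distinct [r, a, b, c]" "distinct [a, b, c, r]"
      using that \<open>\<gamma> a c r\<close> ne[of a b r] ne[of b c r] ne[of a c r] r by auto
    ultimately show "cyclic4 \<gamma> r a b c" "cyclic4 \<gamma> a b c r"
      unfolding cyclic4_def using that by blast+
  qed
  have sym: "D r a c b" if "D r a b c" "a \<in> \<Omega>" "b \<in> \<Omega>" "c \<in> \<Omega>" for a b c
    using D1(2)[of r a b c] D1(1)[of b c r a] D1(2)[of c b r a] that r by blast
  show ?thesis
  proof (rule ordered_C_setI)
    fix a b c assume abc: "a \<in> \<Omega> - {r}" "b \<in> \<Omega> - {r}" "c \<in> \<Omega> - {r}"
    then have mem: "a \<in> \<Omega>" "b \<in> \<Omega>" "c \<in> \<Omega>" by simp_all
    {
      assume D: "D r a b c"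
      then show "D r a c b"
        using sym mem by blast
      show "\<not> D r b a c"
        using D D2 mem r by blast
      show "\<not> (\<gamma> b a r \<and> \<gamma> a c r) \<and> \<not> (\<gamma> c a r \<and> \<gamma> a b r)"
        using circularly_ordered_D_setD(3,4)[OF \<Omega> r mem D] cyc mem by blast
    next
      fix d assume "D r a b c" "d \<in> \<Omega> - {r}"
      \<comment> \<open>(C3) keeps the root, so the tuple is turned until (D3) replaces
        \<open>a\<close> or \<open>b\<close> by \<open>d\<close>, and then turned back.\<close>
      then show "D r a d c \<or> D r d b c"
        using sym[of a b c] D1(1)[of r a c b] D3[of a r c b d] D1(1)[of d r c b] sym[of d c b]
          D1(1)[of a r c d] sym[of a c d] mem r by blast
    next
      show "\<gamma> a b r \<Longrightarrow> \<gamma> b c r \<Longrightarrow> \<gamma> a c r"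
        using circular_order_cut(2)[OF \<gamma>] mem r by blast
      show "\<not> \<gamma> a a r"
        using ne mem r by blast
      \<comment> \<open>(D4) also asks for \<open>r \<noteq> b\<close>, which holds because the root
        has been removed.\<close>
      show "D r a b b" if "a \<noteq> b"
        using abc r that D4[of r a b b] by blast
      show "\<gamma> a b r \<or> \<gamma> b a r" if "a \<noteq> b"
        using abc r that g1[of a r b] g1[of r b a] g4[of a b r] by blast
    }
  qed
qed

section \<open>Adding the new point\<close>

text \<open>As with an outgroup in phylogenetics, any two old points are closer to each other than
  to the new one. The clause for two occurrences of \<open>None\<close> is dictated by (C4) and
  (C2).\<close>

definition add_outgroup ::
    "('a \<Rightarrow> 'a \<Rightarrow> 'a \<Rightarrow> bool) \<Rightarrow> 'a option \<Rightarrow> 'a option \<Rightarrow> 'a option \<Rightarrow> bool" where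
  "add_outgroup C a b c \<longleftrightarrow>
     (case (b, c) of
        (Some y, Some z) \<Rightarrow> (case a of None \<Rightarrow> True | Some x \<Rightarrow> C x y z)
      | (None, None) \<Rightarrow> a \<noteq> None
      | _ \<Rightarrow> False)"

definition add_top :: "('a \<Rightarrow> 'a \<Rightarrow> bool) \<Rightarrow> 'a option \<Rightarrow> 'a option \<Rightarrow> bool" where
  "add_top lt a b \<longleftrightarrow>
     (case (a, b) of
        (Some x, Some y) \<Rightarrow> lt x y
      | (Some x, None) \<Rightarrow> True
      | _ \<Rightarrow> False)"

lemma add_outgroup_simps [simp]:
  "add_outgroup C (Some x) (Some y) (Some z) \<longleftrightarrow> C x y z"
  "add_outgroup C None (Some y) (Some z)"
  "\<not> add_outgroup C a None (Some z)"
  "\<not> add_outgroup C a (Some y) None"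
  "add_outgroup C a None None \<longleftrightarrow> a \<noteq> None"
  by (simp_all add: add_outgroup_def)

lemma add_top_simps [simp]:
  "add_top lt (Some x) (Some y) \<longleftrightarrow> lt x y"
  "add_top lt (Some x) None"
  "\<not> add_top lt None b"
  by (simp_all add: add_top_def)

text \<open>Each point is either new or old. The defining clauses settle the cases that involve
  \<open>None\<close>, and the remaining ones are the axioms for \<open>C\<close> and
  \<open>lt\<close>.\<close>

lemma ordered_C_set_add_outgroup:
  assumes "ordered_C_set \<Theta> C lt"
  shows "ordered_C_set (insert None (Some ` \<Theta>)) (add_outgroup C) (add_top lt)"
proof -
  have C: "C_set \<Theta> C"
    using assms by (simp add: ordered_C_set_def)
  note rules = C_setD[OF C] ordered_C_setD[OF assms]
  have mem: "x \<in> insert None (Some ` \<Theta>) \<longleftrightarrow> x = None \<or> (\<exists>y\<in>\<Theta>. x = Some y)" for x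
    by auto
  show ?thesis
    by (rule ordered_C_setI; unfold mem; elim disjE bexE; hypsubst; (simp; fail)?;
        unfold add_outgroup_simps add_top_simps option.inject; (blast intro: rules dest: rules)?)
qed

section \<open>The stabilizer of the new point\<close>

lemma map_option_permutes_iff:
  "map_option h permutes insert None (Some ` \<Theta>) \<longleftrightarrow> h permutes \<Theta>"
proof
  assume h: "h permutes \<Theta>"
  show "map_option h permutes insert None (Some ` \<Theta>)"
  proof (rule bij_imp_permutes)
    show "bij_betw (map_option h) (insert None (Some ` \<Theta>)) (insert None (Some ` \<Theta>))"
      unfolding bij_betw_def
      using permutes_image[OF h] permutes_inj[OF h]
      by (auto simp: inj_on_def inj_def image_image)
    fix x assume "x \<notin> insert None (Some ` \<Theta>)"
    then show "map_option h x = x"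
      using h by (cases x) (auto simp: permutes_def)
  qed
next
  assume g: "map_option h permutes insert None (Some ` \<Theta>)"
  show "h permutes \<Theta>"
  proof (rule bij_imp_permutes)
    have "inj (map_option h)" using permutes_inj[OF g] .
    then have "inj h" by (auto simp: inj_def) (metis option.inject option.map(2))
    moreover have "h ` \<Theta> = \<Theta>"
    proof -
      have "map_option h ` insert None (Some ` \<Theta>) = insert None (Some ` h ` \<Theta>)"
        by (auto simp: image_image)
      then have "Some ` h ` \<Theta> = Some ` \<Theta>"
        using permutes_image[OF g] by auto
      then show ?thesis
        by (simp add: inj_image_eq_iff)
    qed
    ultimately show "bij_betw h \<Theta> \<Theta>"
      by (simp add: bij_betw_def inj_on_def inj_def)
    fix x assume "x \<notin> \<Theta>"
    then show "h x = x"
      using permutes_not_in[OF g, of "Some x"] by auto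
  qed
qed

lemma D_of_add_outgroup_None:
  "D_of (add_outgroup C) None (Some x) (Some y) (Some z) \<longleftrightarrow> C x y z"
  by (simp add: D_of_def)

lemma circular_of_add_top_None: "circular_of (add_top lt) (Some x) (Some y) None \<longleftrightarrow> lt x y"
  by (simp add: circular_of_def)

text \<open>\<open>C\<close> and \<open>lt\<close> are the values of the new relations with
  \<open>None\<close> inserted, and the new relations are defined from \<open>C\<close>,
  \<open>lt\<close> and \<open>None\<close>. A map that fixes \<open>None\<close> thus preserves
  both pairs of relations or neither.\<close>

lemma map_option_in_Aut_iff:
  "map_option h \<in> Aut (D_structure (insert None (Some ` \<Theta>))
       (D_of (add_outgroup C)) (circular_of (add_top lt))) \<longleftrightarrow>
     h \<in> Aut (C_structure \<Theta> C lt)"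
  (is "?g \<in> Aut (D_structure ?\<Omega> ?D ?\<gamma>) \<longleftrightarrow> _")
proof
  assume g: "?g \<in> Aut (D_structure ?\<Omega> ?D ?\<gamma>)"
  have "C (h x) (h y) (h z) \<longleftrightarrow> C x y z" if "x \<in> \<Theta>" "y \<in> \<Theta>" "z \<in> \<Theta>" for x y z
    using Aut_D_structureD(2)[OF g, of None "Some x" "Some y" "Some z"] that
    by (simp add: D_of_add_outgroup_None)
  moreover have "lt (h x) (h y) \<longleftrightarrow> lt x y" if "x \<in> \<Theta>" "y \<in> \<Theta>" for x y
    using Aut_D_structureD(3)[OF g, of "Some x" "Some y" None] that
    by (simp add: circular_of_add_top_None)
  moreover have "h permutes \<Theta>"
    using Aut_D_structureD(1)[OF g] by (simp add: map_option_permutes_iff)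
  ultimately show "h \<in> Aut (C_structure \<Theta> C lt)"
    by (simp add: Aut_C_structure_iff)
next
  assume h: "h \<in> Aut (C_structure \<Theta> C lt)"
  have C: "add_outgroup C (?g x) (?g y) (?g z) \<longleftrightarrow> add_outgroup C x y z"
    if "x \<in> ?\<Omega>" "y \<in> ?\<Omega>" "z \<in> ?\<Omega>" for x y z
    using that by (auto simp: Aut_C_structureD(2)[OF h])
  have lt: "add_top lt (?g x) (?g y) \<longleftrightarrow> add_top lt x y" if "x \<in> ?\<Omega>" "y \<in> ?\<Omega>" for x y
    using that by (auto simp: Aut_C_structureD(3)[OF h])
  have "?g permutes ?\<Omega>"
    using Aut_C_structureD(1)[OF h] by (simp only: map_option_permutes_iff)
  then show "?g \<in> Aut (D_structure ?\<Omega> ?D ?\<gamma>)"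
    unfolding Aut_D_structure_iff D_of_def circular_of_def
    by (intro conjI ballI; simp only: C lt)
qed

lemma one_point_extension_D_of:
  "one_point_extension (C_structure \<Theta> C lt) (D_structure (insert None (Some ` \<Theta>))
     (D_of (add_outgroup C)) (circular_of (add_top lt)))"
  (is "one_point_extension ?M ?M'")
proof -
  have "{g \<in> Aut ?M'. g None = None} = map_option ` Aut ?M"
  proof (intro equalityI subsetI)
    fix g assume "g \<in> {g \<in> Aut ?M'. g None = None}"
    then have g: "g \<in> Aut ?M'" "g None = None" by simp_all
    have "inj g"
      using Aut_D_structureD(1)[OF g(1)] by (rule permutes_inj)
    \<comment> \<open>This includes \<open>Some x\<close> outside the universe, since a map
      permuting a set is injective on the whole type. Hence \<open>the\<close> never meets
      \<open>None\<close>.\<close>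
    then have "g (Some x) \<noteq> None" for x
      using g(2) by (metis injD option.distinct(1))
    then have "g x = map_option (the \<circ> g \<circ> Some) x" for x
      using g(2) by (cases x) auto
    then have g_eq: "g = map_option (the \<circ> g \<circ> Some)" ..
    with g(1) have "the \<circ> g \<circ> Some \<in> Aut ?M"
      by (metis map_option_in_Aut_iff)
    with g_eq show "g \<in> map_option ` Aut ?M"
      by (rule image_eqI)
  qed (auto simp: map_option_in_Aut_iff)
  moreover have "the \<circ> map_option h \<circ> Some = h" for h :: "'a \<Rightarrow> 'a"
    by auto
  ultimately show ?thesis
    by (simp add: one_point_extension_def image_image)
qed

section \<open>Back and forth\<close>

text \<open>Working with relations makes domain and range symmetric. Since \<open>P\<close> need not
  survive the union of a chain, the conclusion speaks only about finite parts of
  \<open>S\<close>.\<close>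

lemma back_and_forth:
  fixes P :: "('a \<times> 'b) set \<Rightarrow> bool"
  assumes "countable A" "countable B" and P0: "P R0"
    and dom: "\<And>R. P R \<Longrightarrow> R \<subseteq> A \<times> B"
    and forth: "\<And>R a. P R \<Longrightarrow> a \<in> A \<Longrightarrow> \<exists>b. P (insert (a, b) R)"
    and backward: "\<And>R b. P R \<Longrightarrow> b \<in> B \<Longrightarrow> \<exists>a. P (insert (a, b) R)"
  obtains S where "R0 \<subseteq> S" "Domain S = A" "Range S = B"
    "\<And>T. finite T \<Longrightarrow> T \<subseteq> S \<Longrightarrow> \<exists>R. P R \<and> T \<subseteq> R"
proof -
  \<comment> \<open>Stage \<open>n\<close> puts the \<open>n\<close>-th element of each enumeration
    into the domain and the range. The guards cover empty sets, which have no enumeration.\<close>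
  define Q where "Q n R' \<longleftrightarrow> (A \<noteq> {} \<longrightarrow> from_nat_into A n \<in> Domain R') \<and>
    (B \<noteq> {} \<longrightarrow> from_nat_into B n \<in> Range R')" for n R'
  have ex_forth: "\<exists>R'. P R' \<and> R \<subseteq> R' \<and> (A \<noteq> {} \<longrightarrow> from_nat_into A n \<in> Domain R')"
    if R: "P R" for n R
  proof (cases "A = {}")
    case False
    then obtain b where "P (insert (from_nat_into A n, b) R)"
      using forth[OF R from_nat_into] by blast
    then show ?thesis
      by (intro exI[of _ "insert (from_nat_into A n, b) R"]) auto
  qed (use R in auto)
  have ex_back: "\<exists>R'. P R' \<and> R \<subseteq> R' \<and> (B \<noteq> {} \<longrightarrow> from_nat_into B n \<in> Range R')"
    if R: "P R" for n R
  proof (cases "B = {}")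
    case False
    then obtain a where "P (insert (a, from_nat_into B n) R)"
      using backward[OF R from_nat_into] by blast
    then show ?thesis
      by (intro exI[of _ "insert (a, from_nat_into B n) R"]) auto
  qed (use R in auto)
  have step: "\<exists>R'. P R' \<and> R \<subseteq> R' \<and> Q n R'" if R: "P R" for n R
  proof -
    obtain R1 where R1: "P R1" "R \<subseteq> R1" "A \<noteq> {} \<longrightarrow> from_nat_into A n \<in> Domain R1"
      using ex_forth[OF R] by blast
    obtain R2 where R2: "P R2" "R1 \<subseteq> R2" "B \<noteq> {} \<longrightarrow> from_nat_into B n \<in> Range R2"
      using ex_back[OF R1(1)] by blast
    have "Q n R2"
      using R1(3) R2(3) Domain_mono[OF R2(2)] unfolding Q_def by blast
    with R1(2) R2(1,2) show ?thesis by blast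
  qed
  have "\<exists>f. \<forall>n. (P (f n) \<and> R0 \<subseteq> f n) \<and> (f n \<subseteq> f (Suc n) \<and> Q n (f (Suc n)))"
  proof (rule dependent_nat_choice)
    show "\<exists>R. P R \<and> R0 \<subseteq> R" using P0 by blast
    fix R n assume R: "P R \<and> R0 \<subseteq> R"
    then obtain R' where "P R'" "R \<subseteq> R'" "Q n R'"
      using step by blast
    with R show "\<exists>R'. (P R' \<and> R0 \<subseteq> R') \<and> (R \<subseteq> R' \<and> Q n R')"
      by (intro exI[of _ R']) auto
  qed
  then obtain f where "\<forall>n. (P (f n) \<and> R0 \<subseteq> f n) \<and> (f n \<subseteq> f (Suc n) \<and> Q n (f (Suc n)))" ..
  then have f: "P (f n)" "R0 \<subseteq> f n" "f n \<subseteq> f (Suc n)" "Q n (f (Suc n))" for n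
    by simp_all
  have mono: "f m \<subseteq> f n" if "m \<le> n" for m n
    using lift_Suc_mono_le[of f, OF f(3) that] .
  let ?S = "\<Union>n. f n"
  have sub: "f n \<subseteq> ?S" for n by blast
  show thesis
  proof
    show "R0 \<subseteq> ?S" using f(2)[of 0] sub[of 0] by (rule subset_trans)
    have S: "?S \<subseteq> A \<times> B" using dom[OF f(1)] by (rule UN_least)
    have "a \<in> Domain ?S" if a: "a \<in> A" for a
    proof -
      \<comment> \<open>The index of \<open>a\<close> is the stage that treats it; \<open>a\<close>
        is in the domain from the following relation on.\<close>
      have "from_nat_into A (to_nat_on A a) = a" "A \<noteq> {}"
        using \<open>countable A\<close> a by auto
      then have "a \<in> Domain (f (Suc (to_nat_on A a)))"
        using f(4)[of "to_nat_on A a"] unfolding Q_def by simp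
      then show ?thesis using Domain_mono[OF sub] by blast
    qed
    moreover have "Domain ?S \<subseteq> A" using Domain_mono[OF S] by auto
    ultimately show "Domain ?S = A" by (intro equalityI subsetI) auto
    have "b \<in> Range ?S" if b: "b \<in> B" for b
    proof -
      have "from_nat_into B (to_nat_on B b) = b" "B \<noteq> {}"
        using \<open>countable B\<close> b by auto
      then have "b \<in> Range (f (Suc (to_nat_on B b)))"
        using f(4)[of "to_nat_on B b"] unfolding Q_def by simp
      then show ?thesis using Range_mono[OF sub] by blast
    qed
    moreover have "Range ?S \<subseteq> B" using Range_mono[OF S] by auto
    ultimately show "Range ?S = B" by (intro equalityI subsetI) auto
    fix T assume "finite T" "T \<subseteq> ?S"
    \<comment> \<open>The stages increase, so finitely many pairs already lie in a single
      one.\<close>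
    then have "\<exists>n. T \<subseteq> f n"
    proof (induction T)
      case (insert t T)
      then obtain m n where "T \<subseteq> f m" "t \<in> f n" by blast
      then have "insert t T \<subseteq> f (max m n)"
        using mono[of m "max m n"] mono[of n "max m n"] by auto
      then show ?case by (rule exI)
    qed simp
    then obtain n where "T \<subseteq> f n" ..
    then show "\<exists>R. P R \<and> T \<subseteq> R" using f(1) by blast
  qed
qed

section \<open>Partial isomorphisms of a circularly ordered D-set\<close>

text \<open>Partial isomorphisms are kept as relations so that inverting them is taking the
  converse. The clause for equality makes \<open>R\<close> single-valued and injective at
  once.\<close>

definition preserves ::
    "('a \<Rightarrow> 'a \<Rightarrow> 'a \<Rightarrow> 'a \<Rightarrow> bool) \<Rightarrow> ('a \<Rightarrow> 'a \<Rightarrow> 'a \<Rightarrow> bool) \<Rightarrow> ('a \<times> 'a) set \<Rightarrow> bool" where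
  "preserves D \<gamma> R \<longleftrightarrow>
     (\<forall>(a, a')\<in>R. \<forall>(b, b')\<in>R. \<forall>(c, c')\<in>R. \<forall>(d, d')\<in>R.
        (a = b \<longleftrightarrow> a' = b') \<and> (\<gamma> a' b' c' \<longleftrightarrow> \<gamma> a b c) \<and> (D a' b' c' d' \<longleftrightarrow> D a b c d))"

lemma preservesI:
  assumes "\<And>a a' b b'. (a, a') \<in> R \<Longrightarrow> (b, b') \<in> R \<Longrightarrow> a = b \<longleftrightarrow> a' = b'"
    "\<And>a a' b b' c c'. (a, a') \<in> R \<Longrightarrow> (b, b') \<in> R \<Longrightarrow> (c, c') \<in> R \<Longrightarrow>
      \<gamma> a' b' c' \<longleftrightarrow> \<gamma> a b c"
    "\<And>a a' b b' c c' d d'. (a, a') \<in> R \<Longrightarrow> (b, b') \<in> R \<Longrightarrow> (c, c') \<in> R \<Longrightarrow> (d, d') \<in> R \<Longrightarrow>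
      D a' b' c' d' \<longleftrightarrow> D a b c d"
  shows "preserves D \<gamma> R"
  unfolding preserves_def split_paired_Ball_Sigma case_prod_beta
  by (intro ballI conjI; rule assms; simp)

lemma preservesD:
  assumes "preserves D \<gamma> R" "(a, a') \<in> R" "(b, b') \<in> R"
  shows "a = b \<longleftrightarrow> a' = b'"
    "(c, c') \<in> R \<Longrightarrow> \<gamma> a' b' c' \<longleftrightarrow> \<gamma> a b c"
    "(c, c') \<in> R \<Longrightarrow> (d, d') \<in> R \<Longrightarrow> D a' b' c' d' \<longleftrightarrow> D a b c d"
proof -
  have ax: "(a = b \<longleftrightarrow> a' = b') \<and> (\<gamma> a' b' c' \<longleftrightarrow> \<gamma> a b c) \<and> (D a' b' c' d' \<longleftrightarrow> D a b c d)"
    if "(c, c') \<in> R" "(d, d') \<in> R" for c c' d d'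
    using assms(1)[unfolded preserves_def, THEN bspec, OF assms(2), simplified prod.case,
        THEN bspec, OF assms(3), simplified prod.case, THEN bspec, OF that(1),
        simplified prod.case, THEN bspec, OF that(2), simplified prod.case] .
  show "a = b \<longleftrightarrow> a' = b'"
    using ax[OF assms(2,2)] by blast
  show "(c, c') \<in> R \<Longrightarrow> \<gamma> a' b' c' \<longleftrightarrow> \<gamma> a b c"
    using ax[of c c' c c'] by blast
  show "(c, c') \<in> R \<Longrightarrow> (d, d') \<in> R \<Longrightarrow> D a' b' c' d' \<longleftrightarrow> D a b c d"
    using ax[of c c' d d'] by blast
qed

lemma preserves_subset:
  assumes "preserves D \<gamma> R" "S \<subseteq> R"
  shows "preserves D \<gamma> S"
  by (rule preservesI;
      (rule preservesD(1)[OF assms(1)] preservesD(2)[OF assms(1)] preservesD(3)[OF assms(1)]);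
      erule subsetD[OF assms(2)])

lemma preserves_converse:
  assumes "preserves D \<gamma> R"
  shows "preserves D \<gamma> (R\<inverse>)"
  by (rule preservesI; rule sym;
      (rule preservesD(1)[OF assms] preservesD(2)[OF assms] preservesD(3)[OF assms]);
      erule converseD)

lemma preserves_graph:
  "preserves D \<gamma> ((\<lambda>a. (a, f a)) ` A) \<longleftrightarrow>
     inj_on f A \<and>
     (\<forall>a\<in>A. \<forall>b\<in>A. \<forall>c\<in>A. \<gamma> (f a) (f b) (f c) \<longleftrightarrow> \<gamma> a b c) \<and>
     (\<forall>a\<in>A. \<forall>b\<in>A. \<forall>c\<in>A. \<forall>d\<in>A. D (f a) (f b) (f c) (f d) \<longleftrightarrow> D a b c d)"
  (is "preserves D \<gamma> ?R \<longleftrightarrow> ?pres")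
proof
  have graph: "(a, f a) \<in> ?R" if "a \<in> A" for a
    using that by simp
  assume "preserves D \<gamma> ?R"
  note pres = preservesD[OF this graph graph]
  show ?pres
  proof (intro conjI ballI inj_onI)
    fix a b assume ab: "a \<in> A" "b \<in> A"
    show "f a = f b \<Longrightarrow> a = b" by (simp only: pres(1)[OF ab])
    fix c assume c: "c \<in> A"
    show "\<gamma> (f a) (f b) (f c) \<longleftrightarrow> \<gamma> a b c" by (rule pres(2)[OF ab graph[OF c]])
    fix d assume d: "d \<in> A"
    show "D (f a) (f b) (f c) (f d) \<longleftrightarrow> D a b c d"
      by (rule pres(3)[OF ab graph[OF c] graph[OF d]])
  qed
next
  assume ?pres
  then show "preserves D \<gamma> ?R"
    by (intro preservesI) (auto dest: inj_onD)
qed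

lemma preserves_imp_graph:
  assumes "preserves D \<gamma> R"
  obtains f where "R = (\<lambda>a. (a, f a)) ` Domain R"
proof -
  have "\<forall>a\<in>Domain R. \<exists>b. (a, b) \<in> R" by auto
  then obtain f where f: "\<forall>a\<in>Domain R. (a, f a) \<in> R" using bchoice by metis
  have "R = (\<lambda>a. (a, f a)) ` Domain R"
  proof (intro equalityI subsetI)
    fix p assume p: "p \<in> R"
    then have "fst p \<in> Domain R" by (auto simp: Domain_fst)
    then have "(fst p, f (fst p)) \<in> R" using f by blast
    moreover have "(fst p, snd p) \<in> R" using p by simp
    ultimately have "snd p = f (fst p)" using preservesD(1)[OF assms] by blast
    then have "p = (fst p, f (fst p))" by (simp add: prod_eq_iff)
    then show "p \<in> (\<lambda>a. (a, f a)) ` Domain R" using \<open>fst p \<in> Domain R\<close> by (rule image_eqI)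
  qed (use f in blast)
  then show thesis by (rule that)
qed

text \<open>By \<open>D_set_rooted\<close> and \<open>circular_order_rooted\<close> all values of
  \<open>D\<close> and \<open>\<gamma>\<close> on \<open>A\<close> are determined by those seen from
  \<open>r\<close>, and likewise on the image from \<open>f r\<close>. Tuples that repeat the root
  take care of themselves.\<close>

lemma preserves_rooted:
  assumes \<Omega>: "circularly_ordered_D_set \<Omega> D \<gamma>" and A: "A \<subseteq> \<Omega>" "r \<in> A" and f: "inj_on f A" "f ` A \<subseteq> \<Omega>"
    and D: "\<And>a b c. a \<in> A - {r} \<Longrightarrow> b \<in> A - {r} \<Longrightarrow> c \<in> A - {r} \<Longrightarrow>
      D r a b c \<longleftrightarrow> D (f r) (f a) (f b) (f c)"
    and \<gamma>: "\<And>a b. a \<in> A - {r} \<Longrightarrow> b \<in> A - {r} \<Longrightarrow> \<gamma> a b r \<longleftrightarrow> \<gamma> (f a) (f b) (f r)"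
  shows "preserves D \<gamma> ((\<lambda>a. (a, f a)) ` A)"
proof -
  have Dset: "D_set \<Omega> D" and circ: "circular_order \<Omega> \<gamma>"
    using \<Omega> by (auto simp: circularly_ordered_D_set_def)
  have mem: "a \<in> \<Omega>" "f a \<in> \<Omega>" if "a \<in> A" for a
    using that A f by auto
  have eq_r: "f a = f r \<longleftrightarrow> a = r" if "a \<in> A" for a
    using that A(2) f(1) by (auto dest: inj_onD)
  note deg = D_set_degenerate[OF Dset]
  have D': "D (f r) (f a) (f b) (f c) \<longleftrightarrow> D r a b c" if abc: "a \<in> A" "b \<in> A" "c \<in> A" for a b c
  proof -
    consider "a = r" | "b = r" | "c = r" | "a \<noteq> r" "b \<noteq> r" "c \<noteq> r" by blast
    then show ?thesis
    proof cases
      case 1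
      then show ?thesis
        using deg(1)[of r b c] deg(1)[of "f r" "f b" "f c"] mem abc A(2) eq_r by simp
    next
      case 2
      then show ?thesis
        using deg(2)[of r a c] deg(2)[of "f r" "f a" "f c"] mem abc by simp
    next
      case 3
      then show ?thesis
        using deg(3)[of r a b] deg(3)[of "f r" "f a" "f b"] mem abc by simp
    next
      case 4
      with abc show ?thesis using D[of a b c] by simp
    qed
  qed
  have ne: "\<not> \<gamma> r b r" "\<not> \<gamma> a r r" if "a \<in> \<Omega>" "b \<in> \<Omega>" "r \<in> \<Omega>" for a b r
    using circular_orderD(5)[OF circ] that by blast+
  have \<gamma>': "cut \<gamma> (f r) (f a) (f b) \<longleftrightarrow> cut \<gamma> r a b" if ab: "a \<in> A" "b \<in> A" for a b
  proof (cases "a = r \<or> b = r")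
    case True
    then show ?thesis
      using ne(1)[of r b r] ne(1)[of r "f b" "f r"] ne(2)[of a b r] ne(2)[of "f a" "f b" "f r"]
        mem ab A(2) eq_r by (auto simp: cut_def)
  next
    case False
    with ab show ?thesis using \<gamma>[of a b] eq_r by (simp add: cut_def)
  qed
  show ?thesis
    unfolding preserves_graph
  proof (intro conjI ballI)
    show "inj_on f A" by (fact f(1))
    fix a b c assume abc: "a \<in> A" "b \<in> A" "c \<in> A"
    note circ_r = circular_order_rooted[OF circ]
    show "\<gamma> (f a) (f b) (f c) \<longleftrightarrow> \<gamma> a b c"
      unfolding circ_r[OF mem(2)[OF A(2)] mem(2)[OF abc(1)] mem(2)[OF abc(2)] mem(2)[OF abc(3)]]
        circ_r[OF mem(1)[OF A(2)] mem(1)[OF abc(1)] mem(1)[OF abc(2)] mem(1)[OF abc(3)]]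
        circular_of_def
      by (simp only: \<gamma>' abc)
    fix d assume d: "d \<in> A"
    note D_r = D_set_rooted[OF Dset]
    show "D (f a) (f b) (f c) (f d) \<longleftrightarrow> D a b c d"
      unfolding D_r[OF mem(2)[OF A(2)] mem(2)[OF abc(1)] mem(2)[OF abc(2)] mem(2)[OF abc(3)] mem(2)[OF d]]
        D_r[OF mem(1)[OF A(2)] mem(1)[OF abc(1)] mem(1)[OF abc(2)] mem(1)[OF abc(3)] mem(1)[OF d]]
        D_of_def
      by (simp only: D' abc d)
  qed
qed

lemma preserves_extend:
  fixes \<Theta> :: "'a set"
  defines "\<Omega> \<equiv> insert None (Some ` \<Theta>)"
  assumes gen: "generic_ordered_C_set \<Theta> C lt"
    and \<Omega>: "circularly_ordered_D_set \<Omega> D \<gamma>"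
    and can: "canonical_form zero_pos (C_structure \<Theta> C lt) (D_structure \<Omega> D \<gamma>)"
    and R: "preserves D \<gamma> R" "finite R" "R \<subseteq> \<Omega> \<times> \<Omega>" "(r, None) \<in> R"
    and "p \<in> \<Omega>"
  shows "\<exists>q\<in>\<Omega>. preserves D \<gamma> (insert (p, q) R)"
proof (cases "p \<in> Domain R")
  case True
  then obtain q where "(p, q) \<in> R" by blast
  then have "q \<in> \<Omega>" "insert (p, q) R = R" using R(3) by auto
  with R(1) show ?thesis by (intro bexI[of _ q]) simp_all
next
  case False
  note can' = can[unfolded \<Omega>_def canonical_form_D_structure, folded \<Omega>_def]
  have canD: "D None (Some x) (Some y) (Some z) \<longleftrightarrow> C x y z" if "x \<in> \<Theta>" "y \<in> \<Theta>" "z \<in> \<Theta>" for x y z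
    using can'[THEN conjunct1, THEN bspec, THEN bspec, THEN bspec, OF that] by (rule sym)
  have can\<gamma>: "\<gamma> (Some x) (Some y) None \<longleftrightarrow> lt x y" if "x \<in> \<Theta>" "y \<in> \<Theta>" for x y
    using can'[THEN conjunct2, THEN bspec, THEN bspec, OF that] by (rule sym)
  obtain f where f: "R = (\<lambda>a. (a, f a)) ` Domain R"
    using preserves_imp_graph[OF R(1)] .
  define F where "F = Domain R"
  have R_eq: "R = (\<lambda>a. (a, f a)) ` F" using f by (simp only: F_def)
  have graph: "(a, f a) \<in> R" if "a \<in> F" for a
    unfolding R_eq using that by (rule imageI)
  have "finite F" unfolding F_def using R(2) by (rule finite_Domain)
  have "p \<notin> F" unfolding F_def by (fact False)
  have "r \<in> F" unfolding F_def using R(4) by (rule DomainI)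
  have F\<Omega>: "a \<in> \<Omega>" "f a \<in> \<Omega>" if "a \<in> F" for a
    using graph[OF that] R(3) by auto
  have "f r = None"
    using preservesD(1)[OF R(1) graph[OF \<open>r \<in> F\<close>] R(4)] by simp
  have f_eq: "a = b \<longleftrightarrow> f a = f b" if "a \<in> F" "b \<in> F" for a b
    using preservesD(1)[OF R(1) graph[OF that(1)] graph[OF that(2)]] .
  let ?A = "insert p F - {r}" and ?B = "F - {r}"
  \<comment> \<open>Since only \<open>r\<close> is sent to \<open>None\<close>, removing
    \<open>r\<close> from the domain leaves a map into \<open>\<Theta>\<close>. By the canonical
    form it embeds the ordered C-set rooted at \<open>r\<close>.\<close>
  define e where "e = the \<circ> f"
  have Some_f: "f a = Some (e a)" "e a \<in> \<Theta>" if "a \<in> ?B" for a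
  proof -
    have "f a \<noteq> None"
      using that f_eq[of a r] \<open>r \<in> F\<close> \<open>f r = None\<close> by auto
    moreover have "f a \<in> \<Omega>" using that F\<Omega> by blast
    ultimately show "f a = Some (e a)" "e a \<in> \<Theta>" unfolding \<Omega>_def e_def by auto
  qed
  have emb: "embedding (C_structure ?B (D r) (\<lambda>x y. \<gamma> x y r)) (C_structure \<Theta> C lt) e"
    unfolding embedding_C_structure
  proof (intro conjI ballI)
    show "inj_on e ?B"
    proof (rule inj_onI)
      fix x y assume "x \<in> ?B" "y \<in> ?B" "e x = e y"
      then have "f x = f y" using Some_f(1)[of x] Some_f(1)[of y] by (simp only:)
      then show "x = y" using f_eq \<open>x \<in> ?B\<close> \<open>y \<in> ?B\<close> by blast
    qed
    show "e ` ?B \<subseteq> \<Theta>" using Some_f(2) by (rule image_subsetI)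
    fix x y assume x: "x \<in> ?B" and y: "y \<in> ?B"
    then have F: "x \<in> F" "y \<in> F" by simp_all
    have "\<gamma> (f x) (f y) (f r) \<longleftrightarrow> \<gamma> x y r"
      using preservesD(2)[OF R(1) graph graph graph, OF F \<open>r \<in> F\<close>] .
    then show "lt (e x) (e y) \<longleftrightarrow> \<gamma> x y r"
      unfolding Some_f(1)[OF x] Some_f(1)[OF y] \<open>f r = None\<close>
        can\<gamma>[OF Some_f(2)[OF x] Some_f(2)[OF y]] .
    fix z assume z: "z \<in> ?B"
    then have "z \<in> F" by simp
    have "D (f r) (f x) (f y) (f z) \<longleftrightarrow> D r x y z"
      using preservesD(3)[OF R(1) graph graph graph graph, OF \<open>r \<in> F\<close> F \<open>z \<in> F\<close>] .
    then show "C (e x) (e y) (e z) \<longleftrightarrow> D r x y z"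
      unfolding Some_f(1)[OF x] Some_f(1)[OF y] Some_f(1)[OF z] \<open>f r = None\<close>
        canD[OF Some_f(2)[OF x] Some_f(2)[OF y] Some_f(2)[OF z]] .
  qed
  have ord: "ordered_C_set ?A (D r) (\<lambda>x y. \<gamma> x y r)"
  proof (rule ordered_C_set_subset)
    show "ordered_C_set (\<Omega> - {r}) (D r) (\<lambda>x y. \<gamma> x y r)"
      using ordered_C_set_rooted[OF \<Omega>] F\<Omega>(1)[OF \<open>r \<in> F\<close>] .
    show "?A \<subseteq> \<Omega> - {r}" using F\<Omega>(1) \<open>p \<in> \<Omega>\<close> by auto
  qed
  have A: "finite ?A" "?B \<subseteq> ?A" using \<open>finite F\<close> by auto
  obtain h where
    h: "embedding (C_structure ?A (D r) (\<lambda>x y. \<gamma> x y r)) (C_structure \<Theta> C lt) h"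
      and hf: "\<forall>b\<in>?B. h b = e b"
    by (rule generic_ordered_C_set_extension[OF gen A(1) ord A(2) emb])
  \<comment> \<open>The extension \<open>h\<close> is brought back to \<open>\<Omega>\<close>, with
    the root again sent to \<open>None\<close>; \<open>k p\<close> is the wanted image.\<close>
  define k where "k a = (if a = r then None else Some (h a))" for a
  note h' = h[unfolded embedding_C_structure]
  note hA = h'[THEN conjunct1] h'[THEN conjunct2, THEN conjunct1]
    h'[THEN conjunct2, THEN conjunct2, THEN conjunct1]
    h'[THEN conjunct2, THEN conjunct2, THEN conjunct2]
  have k_r: "k r = None" by (simp add: k_def)
  have k_A: "k a = Some (h a)" "h a \<in> \<Theta>" if "a \<in> ?A" for a
    using that hA(2) by (auto simp: k_def)
  have "k a = f a" if "a \<in> F" for a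
    using that bspec[OF hf, of a] Some_f(1)[of a] \<open>f r = None\<close> by (cases "a = r") (auto simp: k_def)
  then have "insert (p, k p) R = (\<lambda>a. (a, k a)) ` insert p F"
    unfolding R_eq by simp
  moreover have "preserves D \<gamma> ((\<lambda>a. (a, k a)) ` insert p F)"
  proof (rule preserves_rooted[OF \<Omega>])
    show "insert p F \<subseteq> \<Omega>" "r \<in> insert p F" using F\<Omega>(1) \<open>p \<in> \<Omega>\<close> \<open>r \<in> F\<close> by auto
    show "inj_on k (insert p F)"
    proof (rule inj_onI)
      fix x y assume "x \<in> insert p F" "y \<in> insert p F" "k x = k y"
      then show "x = y"
        using inj_onD[OF hA(1), of x y] by (cases "x = r"; cases "y = r") (simp_all add: k_def)
    qed
    have "k a \<in> \<Omega>" if "a \<in> insert p F" for a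
      using that k_r k_A[of a] by (cases "a = r") (simp_all add: \<Omega>_def)
    then show "k ` insert p F \<subseteq> \<Omega>" by (rule image_subsetI)
    show "D r a b c \<longleftrightarrow> D (k r) (k a) (k b) (k c)" if a: "a \<in> ?A" and b: "b \<in> ?A" and c: "c \<in> ?A" for a b c
      unfolding k_r k_A(1)[OF a] k_A(1)[OF b] k_A(1)[OF c]
        canD[OF k_A(2)[OF a] k_A(2)[OF b] k_A(2)[OF c]]
      using hA(3)[THEN bspec, OF a, THEN bspec, OF b, THEN bspec, OF c] by (rule sym)
    show "\<gamma> a b r \<longleftrightarrow> \<gamma> (k a) (k b) (k r)" if a: "a \<in> ?A" and b: "b \<in> ?A" for a b
      unfolding k_r k_A(1)[OF a] k_A(1)[OF b] can\<gamma>[OF k_A(2)[OF a] k_A(2)[OF b]]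
      using hA(4)[THEN bspec, OF a, THEN bspec, OF b] by (rule sym)
  qed
  moreover have "k p \<in> \<Omega>"
    using k_r k_A[of p] by (cases "p = r") (simp_all add: \<Omega>_def)
  ultimately show ?thesis by (intro bexI[of _ "k p"]) simp_all
qed

text \<open>Besides the root there is only one point, so the conditions of
  \<open>preserves_rooted\<close> compare \<open>D\<close> and \<open>\<gamma>\<close> at repeated
  arguments, where both sides are false.\<close>

lemma preserves_swap:
  assumes \<Omega>: "circularly_ordered_D_set \<Omega> D \<gamma>" and mem: "r \<in> \<Omega>" "x \<in> \<Omega>" and "r \<noteq> x"
  shows "preserves D \<gamma> {(r, x), (x, r)}"
proof -
  define f where "f a = (if a = r then x else r)" for a
  have f: "f r = x" "f x = r"
    using \<open>r \<noteq> x\<close> by (simp_all add: f_def)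
  have "{r, x} - {r} = {x}"
    using \<open>r \<noteq> x\<close> by auto
  moreover have "\<not> D a b b b" if "a \<in> \<Omega>" "b \<in> \<Omega>" for a b
    using D_setD(3)[OF circularly_ordered_D_setD(1)[OF \<Omega>] that(1,2,2,2)] by blast
  moreover have "\<not> \<gamma> b b a" if "a \<in> \<Omega>" "b \<in> \<Omega>" for a b
    using circular_orderD(5)[OF circularly_ordered_D_setD(2)[OF \<Omega>] that(2,2,1)] by blast
  ultimately have "preserves D \<gamma> ((\<lambda>a. (a, f a)) ` {r, x})"
    using mem \<open>r \<noteq> x\<close> by (intro preserves_rooted[OF \<Omega>, of _ r]) (simp_all add: f)
  then show ?thesis by (simp add: f)
qed

section \<open>Automorphisms from back and forth\<close>

lemma Aut_of_preserves:
  assumes pres: "preserves D \<gamma> S" and "Domain S = \<Omega>" "Range S = \<Omega>"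
  obtains g where "g \<in> Aut (D_structure \<Omega> D \<gamma>)" "\<And>a b. (a, b) \<in> S \<Longrightarrow> g a = b"
proof -
  obtain f where f: "S = (\<lambda>a. (a, f a)) ` \<Omega>"
    using preserves_imp_graph[OF pres] assms(2) by metis
  \<comment> \<open>Outside \<open>\<Omega>\<close> the map must be the identity, as
    \<open>Aut\<close> demands.\<close>
  define g where "g a = (if a \<in> \<Omega> then f a else a)" for a
  have g: "S = (\<lambda>a. (a, g a)) ` \<Omega>"
    unfolding f by (intro image_cong) (simp_all add: g_def)
  note pres_g = pres[unfolded g preserves_graph]
  have "g ` \<Omega> = \<Omega>"
    using assms(3) unfolding g by (simp add: Range_snd image_image)
  with pres_g have "bij_betw g \<Omega> \<Omega>"
    by (simp add: bij_betw_def)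
  then have "g permutes \<Omega>"
    by (rule bij_imp_permutes) (simp add: g_def)
  then have "g \<in> Aut (D_structure \<Omega> D \<gamma>)"
    unfolding Aut_D_structure_iff
    using pres_g[THEN conjunct2, THEN conjunct1] pres_g[THEN conjunct2, THEN conjunct2]
    by (intro conjI)
  moreover have "g a = b" if "(a, b) \<in> S" for a b
    using that unfolding g by auto
  ultimately show thesis by (rule that)
qed

lemma Aut_swap:
  fixes \<Theta> :: "'a set"
  defines "\<Omega> \<equiv> insert None (Some ` \<Theta>)"
  assumes gen: "generic_ordered_C_set \<Theta> C lt"
    and \<Omega>: "circularly_ordered_D_set \<Omega> D \<gamma>"
    and can: "canonical_form zero_pos (C_structure \<Theta> C lt) (D_structure \<Omega> D \<gamma>)"
    and "x \<in> \<Omega>"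
  obtains g where "g \<in> Aut (D_structure \<Omega> D \<gamma>)" "g None = x" "g x = None"
proof (cases "x = None")
  case True
  then show ?thesis using that[OF id_in_Aut_D_structure] by simp
next
  case False
  \<comment> \<open>The pair \<open>(x, None)\<close> provides the root for
    \<open>preserves_extend\<close>. Keeping \<open>(None, x)\<close> too makes \<open>P\<close>
    invariant under converse, so the backward step follows from the forward one.\<close>
  define P where "P R \<longleftrightarrow> preserves D \<gamma> R \<and> finite R \<and> R \<subseteq> \<Omega> \<times> \<Omega> \<and>
    (None, x) \<in> R \<and> (x, None) \<in> R" for R
  note extend = preserves_extend[OF gen \<Omega>[unfolded \<Omega>_def] can[unfolded \<Omega>_def], folded \<Omega>_def]
  have forth: "\<exists>b. P (insert (a, b) R)" if R: "P R" and a: "a \<in> \<Omega>" for R a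
  proof -
    have "preserves D \<gamma> R" "finite R" "R \<subseteq> \<Omega> \<times> \<Omega>" "(x, None) \<in> R"
      using R by (simp_all add: P_def)
    from extend[OF this a] obtain b where "b \<in> \<Omega>" "preserves D \<gamma> (insert (a, b) R)" ..
    then show ?thesis
      using R a by (intro exI[of _ b]) (simp add: P_def)
  qed
  have P_converse: "P (R\<inverse>)" if "P R" for R
    using that unfolding P_def by (auto intro: preserves_converse)
  have backward: "\<exists>a. P (insert (a, b) R)" if R: "P R" and b: "b \<in> \<Omega>" for R b
  proof -
    obtain a where a: "P (insert (b, a) (R\<inverse>))"
      using forth[OF P_converse[OF R] b] ..
    have "(insert (b, a) (R\<inverse>))\<inverse> = insert (a, b) R" by auto
    with P_converse[OF a] have "P (insert (a, b) R)" by (simp only:)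
    then show ?thesis by (rule exI[of _ a])
  qed
  have count: "countable \<Omega>"
    using gen unfolding \<Omega>_def generic_ordered_C_set_def Fraisse_limit_def by simp
  have "None \<in> \<Omega>" by (simp add: \<Omega>_def)
  with \<open>x \<in> \<Omega>\<close> have "P {(None, x), (x, None)}"
    using preserves_swap[OF \<Omega>, of None x] False by (simp add: P_def)
  moreover have "R \<subseteq> \<Omega> \<times> \<Omega>" if "P R" for R
    using that by (simp add: P_def)
  ultimately obtain S where S: "{(None, x), (x, None)} \<subseteq> S" "Domain S = \<Omega>" "Range S = \<Omega>"
    "\<And>T. finite T \<Longrightarrow> T \<subseteq> S \<Longrightarrow> \<exists>R. P R \<and> T \<subseteq> R"
    using back_and_forth[of \<Omega> \<Omega> P, OF count count _ _ forth backward] by metis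
  \<comment> \<open>Every clause of \<open>preserves\<close> involves at most four pairs, so it can
    be checked on finite parts of \<open>S\<close>, each contained in a relation satisfying
    \<open>P\<close>.\<close>
  have finite_pres: "preserves D \<gamma> T" if T: "finite T" "T \<subseteq> S" for T
  proof -
    obtain R where "P R" "T \<subseteq> R" using S(4)[OF T] by blast
    then show ?thesis by (auto simp: P_def intro: preserves_subset)
  qed
  have "preserves D \<gamma> S"
  proof (rule preservesI)
    fix a a' b b' assume ab: "(a, a') \<in> S" "(b, b') \<in> S"
    show "a = b \<longleftrightarrow> a' = b'"
      by (rule preservesD(1)[OF finite_pres[of "{(a, a'), (b, b')}"]]) (use ab in simp_all)
    fix c c' assume c: "(c, c') \<in> S"
    show "\<gamma> a' b' c' \<longleftrightarrow> \<gamma> a b c"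
      by (rule preservesD(2)[OF finite_pres[of "{(a, a'), (b, b'), (c, c')}"]])
        (use ab c in simp_all)
    fix d d' assume d: "(d, d') \<in> S"
    show "D a' b' c' d' \<longleftrightarrow> D a b c d"
      by (rule preservesD(3)[OF finite_pres[of "{(a, a'), (b, b'), (c, c'), (d, d')}"]])
        (use ab c d in simp_all)
  qed
  then obtain g where "g \<in> Aut (D_structure \<Omega> D \<gamma>)" "\<And>a b. (a, b) \<in> S \<Longrightarrow> g a = b"
    using Aut_of_preserves[OF _ S(2,3)] by metis
  then show ?thesis using S(1) that by blast
qed

theorem proposition6p10:
  fixes \<Theta> :: "'a set"
    and C :: "'a \<Rightarrow> 'a \<Rightarrow> 'a \<Rightarrow> bool"
    and lt :: "'a \<Rightarrow> 'a \<Rightarrow> bool"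
  assumes "generic_ordered_C_set \<Theta> C lt"
  shows "\<exists>(D :: 'a option \<Rightarrow> 'a option \<Rightarrow> 'a option \<Rightarrow> 'a option \<Rightarrow> bool)
           (\<gamma> :: 'a option \<Rightarrow> 'a option \<Rightarrow> 'a option \<Rightarrow> bool).
           transitive_extension (C_structure \<Theta> C lt)
             (D_structure (insert None (Some ` \<Theta>)) D \<gamma>) \<and>
           canonical_form zero_pos (C_structure \<Theta> C lt)
             (D_structure (insert None (Some ` \<Theta>)) D \<gamma>) \<and>
           circularly_ordered_D_set (insert None (Some ` \<Theta>)) D \<gamma>"
proof (intro exI conjI)
  let ?\<Omega> = "insert None (Some ` \<Theta>)"
  let ?D = "D_of (add_outgroup C)" and ?\<gamma> = "circular_of (add_top lt)"
  let ?M' = "D_structure ?\<Omega> ?D ?\<gamma>"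
  show can: "canonical_form zero_pos (C_structure \<Theta> C lt) ?M'"
    by (simp add: canonical_form_D_structure D_of_add_outgroup_None circular_of_add_top_None)
  show circ: "circularly_ordered_D_set ?\<Omega> ?D ?\<gamma>"
    by (intro circularly_ordered_D_set_of ordered_C_set_add_outgroup
        generic_ordered_C_set_is_ordered_C_set assms)
  have "\<exists>g\<in>Aut ?M'. g x = y" if x: "x \<in> ?\<Omega>" and y: "y \<in> ?\<Omega>" for x y
  proof -
    \<comment> \<open>Every point is exchanged with \<open>None\<close> by some automorphism, so
      \<open>x\<close> is moved to \<open>y\<close> by way of \<open>None\<close>.\<close>
    obtain g where g: "g \<in> Aut ?M'" "g x = None"
      using Aut_swap[OF assms circ can x] .
    obtain h where h: "h \<in> Aut ?M'" "h None = y"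
      using Aut_swap[OF assms circ can y] .
    show ?thesis
      using comp_in_Aut_D_structure[OF h(1) g(1)] g(2) h(2) by (intro bexI[of _ "h \<circ> g"]) simp_all
  qed
  then show "transitive_extension (C_structure \<Theta> C lt) ?M'"
    unfolding transitive_extension_def D_structure_simps
    by (intro conjI ballI one_point_extension_D_of)
qed

end
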